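(* For any $n\ge1$, writing $\epsilon_{\mathrm{odd}}(F)$ for the expression equal to $0$ if $n$ is even and $F$ if $n$ is odd, and $\epsilon_{\mathrm{even}}(F)$ for $F$ if $n$ is even and $0$ if $n$ is odd: (i) $\sum_{\pi\in\mathfrak{S}_n(132)}(-1)^{\mathsf{des}\,\pi}q^{(2\text{-}31)\pi}=\sum_{\pi\in\mathfrak{S}_n(132)}(-1)^{\mathsf{des}\,\pi}q^{(2\text{-}13)\pi}=\epsilon_{\mathrm{odd}}\big((-q)^{(n-1)/2}C_{(n-1)/2}(q^2)\big)$; (ii) $\sum_{\pi\in\mathfrak{S}_n(213)}(-1)^{\mathsf{des}\,\pi}q^{(31\text{-}2)\pi}=\sum_{\pi\in\mathfrak{S}_n(213)}(-1)^{\mathsf{des}\,\pi}q^{(13\text{-}2)\pi}=\epsilon_{\mathrm{odd}}\big((-q)^{(n-1)/2}C_{(n-1)/2}(q^2)\big)$; (iii) $\sum_{\pi\in\mathfrak{S}_n(312)}(-1)^{\mathsf{des}\,\pi}q^{(2\text{-}31)\pi}=\sum_{\pi\in\mathfrak{S}_n(312)}(-1)^{\mathsf{des}\,\pi}q^{(2\text{-}13)\pi}=\epsilon_{\mathrm{odd}}\big((-q)^{(n-1)/2}C_{(n-1)/2}(q^2)\big)$; (iv) $\sum_{\pi\in\mathfrak{D}^*_n(132)}(-1)^{\mathsf{des}\,\pi}q^{(2\text{-}31)\pi}=\epsilon_{\mathrm{even}}\big((-1)^{n/2}\widehat{C}_{n/2}(q)\big)$; (v) $\sum_{\pi\in\mathfrak{D}^*_n(132)}(-q)^{\mathsf{des}\,\pi}q^{(31\text{-}2)\pi}=\epsilon_{\mathrm{even}}\big((-q)^{n/2}\overline{C}_{n/2}(q)\big)$;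 (vi) $\sum_{\pi\in\mathfrak{D}^*_n(213)}(-1)^{\mathsf{des}\,\pi}q^{(13\text{-}2)\pi}=\epsilon_{\mathrm{even}}\big((-1)^{n/2}q^{(n-2)/2}C_{(n-2)/2}(q^2)\big)$; (vii) $\sum_{\pi\in\mathfrak{D}^*_n(213)}(-q)^{\mathsf{des}\,\pi}q^{(31\text{-}2)\pi}=\epsilon_{\mathrm{even}}\big((-1)^{n/2}q^{(3n-4)/2}C_{(n-2)/2}(q^2)\big)$; where $\widehat{C}_m(q):=\sum_{\pi\in\mathfrak{A}_{2m}(231)}q^{(13\text{-}2)\pi}$ and $\overline{C}_m(q):=\sum_{\pi\in\mathfrak{A}_{2m}(231)}q^{(2\text{-}13)\pi}$.
   Context: $C_n(q):=C_n(q,q^2)$, where $C_n(t,q)$ is defined by $\sum_{n\ge0}C_n(t,q)z^n=1/(1-c_1z/(1-c_2z/(1-c_3z/\cdots)))$ with $c_{2k-1}=q^{k-1}$, $c_{2k}=tq^{k-1}$. $\mathfrak{S}_n(\tau)$: permutations of $[n]$ avoiding classical pattern $\tau$. For $\pi\in\mathfrak{S}_n$ set $\pi(n+1)=n+1$; $\pi(i)$ is a foremaximum if $\pi(i)<\pi(i+1)$ and $\pi(i)=\max\{\pi(1),\dots,\pi(i)\}$; a coderangement has no foremaximum; $\mathfrak{D}^*_n(\tau)$ is the set of coderangements in $\mathfrak{S}_n(\tau)$. $\mathfrak{A}_n(\tau)$ is the set of alternating (up-down) permutations $\pi(1)<\pi(2)>\pi(3)<\cdots$ in $\mathfrak{S}_n(\tau)$.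 $\mathsf{des}\,\pi=\#\{i\in[n-1]:\pi(i)>\pi(i+1)\}$; $(31\text{-}2)\pi=\#\{(i,j):i+1<j\le n,\pi(i+1)<\pi(j)<\pi(i)\}$, $(2\text{-}31)\pi=\#\{(i,j):j<i<n,\pi(i+1)<\pi(j)<\pi(i)\}$, $(2\text{-}13)\pi=\#\{(i,j):j<i<n,\pi(i)<\pi(j)<\pi(i+1)\}$, $(13\text{-}2)\pi=\#\{(i,j):i+1<j\le n,\pi(i)<\pi(j)<\pi(i+1)\}$. *)

theory Defs
  imports "HOL-Combinatorics.Multiset_Permutations" "HOL-Computational_Algebra.Formal_Power_Series"
begin

fun sfrac_trunc :: "(nat \<Rightarrow> 'a::field) \<Rightarrow> nat \<Rightarrow> nat \<Rightarrow> 'a fps" where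
  "sfrac_trunc c k 0 = 1"
| "sfrac_trunc c k (Suc d) = inverse (1 - fps_const (c k) * fps_X * sfrac_trunc c (Suc k) d)"

text \<open>The infinite S-fraction 1/(1 - c_1 z/(1 - c_2 z/...)): its n-th coefficient agrees with
  that of any truncation of depth at least n+1 (the truncation error is O(z^(depth))).\<close>
definition sfrac :: "(nat \<Rightarrow> 'a::field) \<Rightarrow> 'a fps" where
  "sfrac c = Abs_fps (\<lambda>n. fps_nth (sfrac_trunc c 1 (Suc n)) n)"

definition cat_weight :: "'a::field \<Rightarrow> 'a \<Rightarrow> nat \<Rightarrow> 'a" where
  "cat_weight t q j = (if odd j then q ^ ((j - 1) div 2) else t * q ^ (j div 2 - 1))"

definition Ctq :: "nat \<Rightarrow> 'a::field \<Rightarrow> 'a \<Rightarrow> 'a" where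
  "Ctq n t q = fps_nth (sfrac (cat_weight t q)) n"

definition Cq :: "nat \<Rightarrow> 'a::field \<Rightarrow> 'a" where
  "Cq n q = Ctq n q (q^2)"

section \<open>Permutations as lists [pi(1),...,pi(n)] (0-indexed positions)\<close>

definition perms :: "nat \<Rightarrow> nat list set" where
  "perms n = permutations_of_set {1..n}"

definition contains :: "nat list \<Rightarrow> nat list \<Rightarrow> bool" where
  "contains p tau \<longleftrightarrow> (\<exists>idx. length idx = length tau \<and> sorted_wrt (<) idx \<and>
      (\<forall>i\<in>set idx. i < length p) \<and>
      (\<forall>a<length tau. \<forall>b<length tau. (p ! (idx ! a) < p ! (idx ! b) \<longleftrightarrow> tau ! a < tau ! b)))"

definition avoiders :: "nat \<Rightarrow> nat list \<Rightarrow> nat list set" where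
  "avoiders n tau = {p \<in> perms n. \<not> contains p tau}"

definition ext :: "nat list \<Rightarrow> nat \<Rightarrow> nat" where
  "ext p i = (if i < length p then p ! i else length p + 1)"

definition foremax :: "nat list \<Rightarrow> nat \<Rightarrow> bool" where
  "foremax p i \<longleftrightarrow> i < length p \<and> ext p i < ext p (Suc i) \<and> (\<forall>k\<le>i. p ! k \<le> p ! i)"

definition coderangement :: "nat list \<Rightarrow> bool" where
  "coderangement p \<longleftrightarrow> (\<forall>i. \<not> foremax p i)"

definition coder_avoiders :: "nat \<Rightarrow> nat list \<Rightarrow> nat list set" where
  "coder_avoiders n tau = {p \<in> avoiders n tau. coderangement p}"

definition alternating :: "nat list \<Rightarrow> bool" where
  "alternating p \<longleftrightarrow> (\<forall>i. Suc i < length p \<longrightarrow>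
      (even i \<longrightarrow> p ! i < p ! Suc i) \<and> (odd i \<longrightarrow> p ! i > p ! Suc i))"

definition alt_avoiders :: "nat \<Rightarrow> nat list \<Rightarrow> nat list set" where
  "alt_avoiders n tau = {p \<in> avoiders n tau. alternating p}"

definition des :: "nat list \<Rightarrow> nat" where
  "des p = card {i. Suc i < length p \<and> p ! i > p ! Suc i}"

definition st31_2 :: "nat list \<Rightarrow> nat" where
  "st31_2 p = card {(i, j). Suc i < j \<and> j < length p \<and> p ! Suc i < p ! j \<and> p ! j < p ! i}"

definition st2_31 :: "nat list \<Rightarrow> nat" where
  "st2_31 p = card {(i, j). j < i \<and> Suc i < length p \<and> p ! Suc i < p ! j \<and> p ! j < p ! i}"

definition st2_13 :: "nat list \<Rightarrow> nat" where
  "st2_13 p = card {(i, j). j < i \<and> Suc i < length p \<and> p ! i < p ! j \<and> p ! j < p ! Suc i}"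

definition st13_2 :: "nat list \<Rightarrow> nat" where
  "st13_2 p = card {(i, j). Suc i < j \<and> j < length p \<and> p ! i < p ! j \<and> p ! j < p ! Suc i}"

definition Chat :: "nat \<Rightarrow> 'a::field \<Rightarrow> 'a" where
  "Chat m q = (\<Sum>p\<in>alt_avoiders (2*m) [2,3,1]. q ^ st13_2 p)"

definition Cbar :: "nat \<Rightarrow> 'a::field \<Rightarrow> 'a" where
  "Cbar m q = (\<Sum>p\<in>alt_avoiders (2*m) [2,3,1]. q ^ st2_13 p)"

definition eps_odd :: "nat \<Rightarrow> 'a::zero \<Rightarrow> 'a" where
  "eps_odd n F = (if odd n then F else 0)"

definition eps_even :: "nat \<Rightarrow> 'a::zero \<Rightarrow> 'a" where
  "eps_even n F = (if even n then F else 0)"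

end

theory Submission
  imports Defs "HOL-Library.Sublist"
begin

text \<open>
  Reversal and complementation carry every class in the theorem to the 231-avoiders, except that
  a coderangement avoiding 213 must start with its maximum and is otherwise an arbitrary
  213-avoider. A 231-avoider splits at its maximum as \<open>L m R\<close> with all of \<open>L\<close> below all of \<open>R\<close>.
  Each statistic is additive under this splitting up to the number of letters above (or below) the
  first letter of a factor, so the generating functions satisfy quadratic functional equations that
  involve only \<open>F(z)\<close> and \<open>F(qz)\<close>. At \<open>-1\<close> (or \<open>-q\<close>) the linear terms cancel and what is left is
  \<open>G(z) = z + c z G(z) G(qz)\<close>. The substitution \<open>G(z) = z F(c q z\<^sup>2)\<close> turns this into
  \<open>F(z) = 1 + z F(z) F(q\<^sup>2 z)\<close>, which is the functional equation of the S-fraction with weights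
  \<open>c\<^sub>j = q\<^bsup>2(j-1)\<^esup>\<close> that defines \<open>C\<^sub>n(q\<^sup>2)\<close>. Alternating 231-avoiders satisfy the same equations
  without signs, which yields the two coderangement sums over 132-avoiders.
\<close>

section \<open>Pattern containment, reversal and complement\<close>

definition order_isomorphic :: "'a::linorder list \<Rightarrow> 'b::linorder list \<Rightarrow> bool" where
  "order_isomorphic xs ys \<longleftrightarrow> length xs = length ys \<and>
    (\<forall>i<length xs. \<forall>j<length xs. xs ! i < xs ! j \<longleftrightarrow> ys ! i < ys ! j)"

lemma order_isomorphic_rev:
  assumes "order_isomorphic xs ys"
  shows "order_isomorphic (rev xs) (rev ys)"
  using assms by (simp add: order_isomorphic_def rev_nth)

lemma order_isomorphic_map_antimono:
  assumes "order_isomorphic xs ys"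
    and "\<And>a b. a \<in> set xs \<Longrightarrow> b \<in> set xs \<Longrightarrow> f a < f b \<longleftrightarrow> b < a"
    and "\<And>a b. a \<in> set ys \<Longrightarrow> b \<in> set ys \<Longrightarrow> g a < g b \<longleftrightarrow> b < a"
  shows "order_isomorphic (map f xs) (map g ys)"
  using assms by (simp add: order_isomorphic_def)

lemma order_isomorphic_triple_iff:
  "order_isomorphic [a, b, c] [x, y, z] \<longleftrightarrow>
    (a < b \<longleftrightarrow> x < y) \<and> (b < a \<longleftrightarrow> y < x) \<and> (a < c \<longleftrightarrow> x < z) \<and>
    (c < a \<longleftrightarrow> z < x) \<and> (b < c \<longleftrightarrow> y < z) \<and> (c < b \<longleftrightarrow> z < y)"
proof -
  have "(\<forall>i<length [a, b, c]. P i) \<longleftrightarrow> P 0 \<and> P 1 \<and> P 2" for P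
    by (simp add: All_less_Suc2 numeral_2_eq_2)
  then show ?thesis unfolding order_isomorphic_def by simp blast
qed

lemma subseq_iff_map_nth:
  "subseq ys xs \<longleftrightarrow> (\<exists>idx. sorted_wrt (<) idx \<and> (\<forall>i\<in>set idx. i < length xs) \<and> ys = map ((!) xs) idx)"
proof
  assume "subseq ys xs"
  then show "\<exists>idx. sorted_wrt (<) idx \<and> (\<forall>i\<in>set idx. i < length xs) \<and> ys = map ((!) xs) idx"
  proof induction
    case (list_emb_Nil xs)
    show ?case by (intro exI[of _ "[]"]) simp
  next
    case (list_emb_Cons ys xs x)
    then obtain idx where "sorted_wrt (<) idx" "\<forall>i\<in>set idx. i < length xs" "ys = map ((!) xs) idx"
      by blast
    then show ?case by (intro exI[of _ "map Suc idx"]) (auto simp: sorted_wrt_map)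
  next
    case (list_emb_Cons2 y x ys xs)
    then obtain idx where "sorted_wrt (<) idx" "\<forall>i\<in>set idx. i < length xs" "ys = map ((!) xs) idx"
      by blast
    with \<open>y = x\<close> show ?case by (intro exI[of _ "0 # map Suc idx"]) (auto simp: sorted_wrt_map)
  qed
next
  assume "\<exists>idx. sorted_wrt (<) idx \<and> (\<forall>i\<in>set idx. i < length xs) \<and> ys = map ((!) xs) idx"
  then obtain idx where idx: "sorted_wrt (<) idx" "\<forall>i\<in>set idx. i < length xs"
    and ys: "ys = map ((!) xs) idx" by blast
  have "subseq idx [0..<length xs]"
    using idx by (intro sorted_subset_imp_subseq) auto
  then have "subseq ys (map ((!) xs) [0..<length xs])"
    unfolding ys by (rule subseq_map)
  then show "subseq ys xs" by (simp add: map_nth)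
qed

lemma contains_iff_subseq: "contains p tau \<longleftrightarrow> (\<exists>ys. subseq ys p \<and> order_isomorphic ys tau)"
proof -
  have "contains p tau \<longleftrightarrow> (\<exists>idx. sorted_wrt (<) idx \<and> (\<forall>i\<in>set idx. i < length p) \<and>
      order_isomorphic (map ((!) p) idx) tau)"
    unfolding contains_def order_isomorphic_def by (intro ex_cong1) auto
  then show ?thesis unfolding subseq_iff_map_nth by blast
qed

lemma contains_triple_iff:
  "contains p [x, y, z] \<longleftrightarrow> (\<exists>a b c. subseq [a, b, c] p \<and> order_isomorphic [a, b, c] [x, y, z])"
proof -
  have "order_isomorphic ys [x, y, z] \<Longrightarrow> \<exists>a b c. ys = [a, b, c]" for ys :: "nat list"
    by (auto simp: order_isomorphic_def length_Suc_conv)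
  then show ?thesis unfolding contains_iff_subseq by blast
qed

lemma subseq_rev: "subseq xs ys \<Longrightarrow> subseq (rev xs) (rev ys)"
  by (induction rule: list_emb.induct) (auto intro: subseq_rev_drop_many list_emb_append_mono)

lemma subseq_imp_subset: "subseq xs ys \<Longrightarrow> set xs \<subseteq> set ys"
  by (auto dest: list_emb_set)

lemma contains_rev: "contains (rev p) (rev tau) \<longleftrightarrow> contains p tau"
proof -
  have "contains (rev p) (rev tau)" if "contains p tau" for p tau
    using that unfolding contains_iff_subseq by (blast intro: subseq_rev order_isomorphic_rev)
  from this[of p tau] this[of "rev p" "rev tau"] show ?thesis by auto
qed

lemma in_perms_iff: "p \<in> perms n \<longleftrightarrow> distinct p \<and> set p = {1..n}"
  by (auto simp: perms_def permutations_of_set_def)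

lemma length_perms: "p \<in> perms n \<Longrightarrow> length p = n"
  by (metis in_perms_iff distinct_card card_atLeastAtMost diff_Suc_1)

lemma perms_bounds: "p \<in> perms n \<Longrightarrow> x \<in> set p \<Longrightarrow> 0 < x \<and> x \<le> n"
  by (auto simp: in_perms_iff)

lemma perms_0: "perms 0 = {[]}"
  by (simp add: perms_def)

lemma rev_perms [simp]: "rev p \<in> perms n \<longleftrightarrow> p \<in> perms n"
  by (simp add: in_perms_iff)

definition compl :: "nat \<Rightarrow> nat list \<Rightarrow> nat list" where
  "compl n p = map (\<lambda>x. Suc n - x) p"

lemma compl_perms: "p \<in> perms n \<Longrightarrow> compl n p \<in> perms n"
proof -
  assume p: "p \<in> perms n"
  have "bij_betw (\<lambda>x. Suc n - x) {1..n} {1..n}"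
    by (rule bij_betw_byWitness[of _ "\<lambda>x. Suc n - x"]) auto
  with p show ?thesis by (simp add: in_perms_iff compl_def distinct_map bij_betw_def)
qed

lemma compl_compl: "p \<in> perms n \<Longrightarrow> compl n (compl n p) = p"
  by (auto simp: compl_def in_perms_iff intro!: map_idI)

lemma contains_compl:
  assumes p: "p \<in> perms n" and tau: "tau \<in> perms m"
  shows "contains (compl n p) (compl m tau) \<longleftrightarrow> contains p tau"
proof -
  have contains_compl_if: "contains (compl n p) (compl m tau)"
    if p: "p \<in> perms n" and tau: "tau \<in> perms m" and "contains p tau" for p tau
  proof -
    from \<open>contains p tau\<close> obtain ys where ys: "subseq ys p" "order_isomorphic ys tau"
      unfolding contains_iff_subseq by blast
    have "x \<le> n" if "x \<in> set ys" for x
      using that ys(1) perms_bounds[OF p] by (metis subseq_order.order_trans subseq_singleton_left)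
    with ys(2) have "order_isomorphic (compl n ys) (compl m tau)"
      unfolding compl_def using perms_bounds[OF tau]
      by (intro order_isomorphic_map_antimono) (auto simp: diff_less_mono2 less_Suc_eq_le)
    with ys(1) show ?thesis
      unfolding contains_iff_subseq compl_def by (blast intro: subseq_map)
  qed
  from contains_compl_if[OF p tau] contains_compl_if[OF compl_perms[OF p] compl_perms[OF tau]]
  show ?thesis
    by (auto simp: compl_compl p tau)
qed

lemma finite_avoiders [simp]: "finite (avoiders n tau)"
  by (simp add: avoiders_def perms_def)

lemma avoiders_imp_perms: "p \<in> avoiders n tau \<Longrightarrow> p \<in> perms n"
  by (simp add: avoiders_def)

lemma sum_avoiders_rev: "(\<Sum>p\<in>avoiders n (rev tau). w p) = (\<Sum>p\<in>avoiders n tau. w (rev p))"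
  using contains_rev[of _ "rev tau"]
  by (intro sum.reindex_bij_witness[of _ rev rev]) (auto simp: avoiders_def contains_rev)

lemma sum_avoiders_compl:
  assumes "tau \<in> perms m"
  shows "(\<Sum>p\<in>avoiders n (compl m tau). w p) = (\<Sum>p\<in>avoiders n tau. w (compl n p))"
  using contains_compl[OF _ compl_perms[OF assms]] assms
  by (intro sum.reindex_bij_witness[of _ "compl n" "compl n"])
    (auto simp: avoiders_def contains_compl compl_compl compl_perms)

section \<open>The decomposition of 231-avoiders at the maximum\<close>

definition avoids_231 :: "'a::linorder list \<Rightarrow> bool" where
  "avoids_231 p \<longleftrightarrow> (\<forall>a b c. subseq [a, b, c] p \<longrightarrow> a < b \<longrightarrow> a \<le> c)"

lemma avoids_231_map_strict_mono:
  assumes "strict_mono f"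
  shows "avoids_231 (map f p) \<longleftrightarrow> avoids_231 p"
proof -
  have "subseq ys (map f p) \<longleftrightarrow> (\<exists>zs. subseq zs p \<and> ys = map f zs)" for ys
    unfolding subseq_conv_nths nths_map by blast
  then have "avoids_231 (map f p) \<longleftrightarrow>
      (\<forall>a b c. subseq [a, b, c] p \<longrightarrow> f a < f b \<longrightarrow> f a \<le> f c)"
    unfolding avoids_231_def by (simp add: Cons_eq_map_conv) blast
  then show ?thesis
    by (simp add: avoids_231_def strict_mono_less[OF assms] strict_mono_less_eq[OF assms])
qed

lemma subseq_triple_append_ConsE:
  assumes "subseq [a, b, c] (L @ m # R)"
  obtains (left) "subseq [a, b, c] L"
    | (across) "a \<in> set L" "c \<in> set (m # R)"
    | (middle) "a = m" "b \<in> set R"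
    | (right) "subseq [a, b, c] R"
proof -
  from assms obtain us vs where "[a, b, c] = us @ vs" "subseq us L" "subseq vs (m # R)"
    by (rule subseq_appendE)
  then show ?thesis
    using that subseq_imp_subset[of us L] subseq_imp_subset[of vs "m # R"]
      subseq_imp_subset[of "[b, c]" R]
    by (cases us; cases "tl us"; cases "tl (tl us)")
      (auto simp: Cons_eq_append_conv split: if_splits)
qed

lemma strict_mono_plus: "strict_mono ((+) k)"
  for k :: nat
  by (simp add: strict_mono_def)

lemma avoids_231_split_max:
  assumes "\<And>x. x \<in> set L \<Longrightarrow> x < m" "\<And>x. x \<in> set R \<Longrightarrow> x < m"
  shows "avoids_231 (L @ m # R) \<longleftrightarrow>
    avoids_231 L \<and> avoids_231 R \<and> (\<forall>a\<in>set L. \<forall>b\<in>set R. a \<le> b)"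
proof
  assume avoids: "avoids_231 (L @ m # R)"
  have "a \<le> b" if "a \<in> set L" "b \<in> set R" for a b
  proof -
    have "subseq ([a] @ [m, b]) (L @ m # R)"
      using that by (intro list_emb_append_mono) (simp_all add: subseq_singleton_left)
    then show ?thesis using avoids assms(1)[OF that(1)] by (auto simp: avoids_231_def)
  qed
  moreover have "avoids_231 L"
    using avoids unfolding avoids_231_def by (blast intro: subseq_rev_drop_many)
  moreover have "avoids_231 R"
    using avoids unfolding avoids_231_def by (blast intro: subseq_drop_many list_emb_Cons)
  ultimately show "avoids_231 L \<and> avoids_231 R \<and> (\<forall>a\<in>set L. \<forall>b\<in>set R. a \<le> b)" by blast
next
  assume split: "avoids_231 L \<and> avoids_231 R \<and> (\<forall>a\<in>set L. \<forall>b\<in>set R. a \<le> b)"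
  show "avoids_231 (L @ m # R)"
    unfolding avoids_231_def
  proof (intro allI impI)
    fix a b c assume "subseq [a, b, c] (L @ m # R)" "a < b"
    from this(1) show "a \<le> c"
    proof (cases rule: subseq_triple_append_ConsE)
      case left
      then show ?thesis using split \<open>a < b\<close> by (auto simp: avoids_231_def)
    next
      case across
      then show ?thesis using split assms(1)[of a] by auto
    next
      case middle
      then show ?thesis using assms(2)[of b] \<open>a < b\<close> by simp
    next
      case right
      then show ?thesis using split \<open>a < b\<close> by (auto simp: avoids_231_def)
    qed
  qed
qed

definition Av231 :: "nat \<Rightarrow> nat list set" where
  "Av231 n = avoiders n [2, 3, 1]"

lemma Av231_iff: "p \<in> Av231 n \<longleftrightarrow> p \<in> perms n \<and> avoids_231 p"
proof -
  have "contains p [2, 3, 1] \<longleftrightarrow> \<not> avoids_231 p"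
    unfolding contains_triple_iff order_isomorphic_triple_iff avoids_231_def
    by (auto simp: not_le) (meson less_asym less_trans)+
  then show ?thesis by (simp add: Av231_def avoiders_def)
qed

lemma Av231_0: "Av231 0 = {[]}"
  by (auto simp: Av231_iff perms_0 avoids_231_def)

definition glue :: "nat list \<Rightarrow> nat list \<Rightarrow> nat list" where
  "glue L R = L @ Suc (length L + length R) # map ((+) (length L)) R"

lemma length_glue: "length (glue L R) = Suc (length L + length R)"
  by (simp add: glue_def)

lemma glue_perms:
  assumes L: "L \<in> perms k" and R: "R \<in> perms l"
  shows "glue L R \<in> perms (Suc (k + l))"
proof -
  have "(+) k ` {1..l} = {Suc k..k + l}" by (simp add: add.commute)
  then show ?thesis
    using assms length_perms[OF L] length_perms[OF R]
    by (auto simp: in_perms_iff glue_def distinct_map)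
qed

lemma glue_Av231:
  assumes L: "L \<in> Av231 k" and R: "R \<in> Av231 l"
  shows "glue L R \<in> Av231 (Suc (k + l))"
proof -
  have p: "L \<in> perms k" "R \<in> perms l" using L R by (simp_all add: Av231_iff)
  note bounds = perms_bounds[OF p(1)] perms_bounds[OF p(2)]
  have "avoids_231 (L @ Suc (k + l) # map ((+) k) R)"
    using L R bounds
    by (subst avoids_231_split_max)
      (fastforce simp: Av231_iff avoids_231_map_strict_mono strict_mono_plus)+
  then show ?thesis
    using glue_perms[OF p] length_perms[OF p(1)] length_perms[OF p(2)]
    by (simp add: Av231_iff glue_def)
qed

lemma consecutive_segments:
  fixes A B :: "nat set"
  assumes un: "A \<union> B = {1..n}" and less: "\<And>a b. a \<in> A \<Longrightarrow> b \<in> B \<Longrightarrow> a < b"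
  shows "A = {1..card A}" "B = {Suc (card A)..n}"
proof -
  define k where "k = Max (insert 0 A)"
  have "finite A" using un by (metis finite_Un finite_atLeastAtMost)
  then have k_max: "k = 0 \<or> k \<in> A" "\<And>a. a \<in> A \<Longrightarrow> a \<le> k"
    unfolding k_def using Max_in[of "insert 0 A"] by auto
  have "A = {1..k}"
  proof (intro equalityI subsetI)
    fix x assume "x \<in> {1..k}"
    then have "k \<in> A" using k_max(1) by auto
    then have "k \<le> n" using un by auto
    then have "x \<in> A \<union> B" using un \<open>x \<in> {1..k}\<close> by auto
    then show "x \<in> A" using less[OF \<open>k \<in> A\<close>, of x] \<open>x \<in> {1..k}\<close> by auto
  qed (use k_max(2) un in auto)
  moreover have "B = {1..n} - A" using un less by fastforce
  ultimately show "A = {1..card A}" "B = {Suc (card A)..n}" by auto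
qed

lemma split_perms_max:
  assumes p: "p \<in> perms (Suc n)"
  obtains L R where "p = L @ Suc n # R" "distinct (L @ R)" "set L \<union> set R = {1..n}"
proof -
  have "Suc n \<in> set p" using p by (simp add: in_perms_iff)
  then obtain L R where p_split: "p = L @ Suc n # R" by (meson split_list)
  moreover have "set L \<union> set R = {1..n}"
  proof -
    have "set L \<union> set R = set p - {Suc n}" using p p_split by (auto simp: in_perms_iff)
    then show ?thesis using p by (simp add: in_perms_iff atLeastAtMostSuc_conv)
  qed
  ultimately show ?thesis using p by (intro that) (auto simp: in_perms_iff)
qed

lemma Av231_SucE:
  assumes p: "p \<in> Av231 (Suc n)"
  obtains k L R where "k \<le> n" "L \<in> Av231 k" "R \<in> Av231 (n - k)" "p = glue L R"
proof -
  have "p \<in> perms (Suc n)" using p by (simp add: Av231_iff)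
  then obtain L R' where p_eq: "p = L @ Suc n # R'" and dist: "distinct (L @ R')"
    and un: "set L \<union> set R' = {1..n}"
    by (rule split_perms_max)
  have "x < Suc n" if "x \<in> set L \<union> set R'" for x using that unfolding un by simp
  then have avoid: "avoids_231 L" "avoids_231 R'" and "\<forall>a\<in>set L. \<forall>b\<in>set R'. a \<le> b"
    using p avoids_231_split_max[of L "Suc n" R'] by (simp_all add: Av231_iff p_eq)
  then have "a < b" if "a \<in> set L" "b \<in> set R'" for a b
    using that dist by (fastforce simp: le_less)
  note initial_final = consecutive_segments[OF un this]
  define k R where "k = length L" and "R = map (\<lambda>x. x - k) R'"
  have "card (set L) = k" using dist by (simp add: distinct_card k_def)
  with initial_final have segments: "set L = {1..k}" "set R' = {Suc k..n}" by simp_all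
  have R': "R' = map ((+) k) R"
    unfolding R_def map_map using segments(2) by (auto simp: k_def intro!: map_idI[symmetric])
  have L: "L \<in> perms k" using segments(1) dist by (simp add: in_perms_iff k_def)
  have kl: "k + length R' = n"
    using distinct_card[OF dist] un by (simp add: k_def)
  then have "(+) k ` set R = (+) k ` {1..n - k}"
    using segments(2) unfolding R' by (simp add: add.commute k_def)
  then have "set R = {1..n - k}" by (rule iffD1[OF inj_image_eq_iff, rotated]) simp
  then have R: "R \<in> perms (n - k)"
    using dist unfolding R' in_perms_iff by (simp add: distinct_map)
  then have "p = glue L R"
    using kl by (simp add: glue_def p_eq k_def[symmetric] R')
  moreover have "avoids_231 R"
    using avoid(2) unfolding R' by (simp add: avoids_231_map_strict_mono strict_mono_plus)
  ultimately show ?thesis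
    using L R avoid(1) kl by (intro that[of k L R]) (simp_all add: Av231_iff)
qed

lemma glue_inject:
  assumes L: "L \<in> perms k" "L' \<in> perms k'" and R: "R \<in> perms l" "R' \<in> perms l'"
    and "k + l = k' + l'"
  shows "glue L R = glue L' R' \<longleftrightarrow> L = L' \<and> R = R'"
proof
  note len = L[THEN length_perms] R[THEN length_perms]
  assume "glue L R = glue L' R'"
  then have "L @ Suc (k + l) # map ((+) k) R = L' @ Suc (k + l) # map ((+) k') R'"
    using assms(5) by (simp add: glue_def len)
  moreover have "Suc (k + l) \<notin> set L" "Suc (k + l) \<notin> set (map ((+) k) R)"
    using L(1) R(1) by (auto simp: in_perms_iff)
  moreover have "Suc (k + l) \<notin> set L'"
    using L(2) assms(5) by (auto simp: in_perms_iff)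
  ultimately have "L = L'" "map ((+) k) R = map ((+) k') R'"
    by (simp_all add: append_Cons_eq_iff)
  moreover from \<open>L = L'\<close> have "k = k'" using len by simp
  ultimately show "L = L' \<and> R = R'" by (simp add: inj_map_eq_map)
qed simp

lemma sum_Av231_Suc:
  "(\<Sum>p\<in>Av231 (Suc n). w p) = (\<Sum>k\<le>n. \<Sum>L\<in>Av231 k. \<Sum>R\<in>Av231 (n - k). w (glue L R))"
proof -
  let ?S = "SIGMA k:{..n}. Av231 k \<times> Av231 (n - k)"
  have "bij_betw (\<lambda>(k, L, R). glue L R) ?S (Av231 (Suc n))"
    unfolding bij_betw_def
  proof
    have "k = k' \<and> L = L' \<and> R = R'"
      if "k \<le> n" "L \<in> Av231 k" "R \<in> Av231 (n - k)"
        and "k' \<le> n" "L' \<in> Av231 k'" "R' \<in> Av231 (n - k')" and "glue L R = glue L' R'"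
      for k k' L L' R R'
      using that glue_inject[of L k L' k' R "n - k" R' "n - k'"]
      by (auto simp: Av231_iff dest: length_perms)
    then show "inj_on (\<lambda>(k, L, R). glue L R) ?S" by (auto simp: inj_on_def)
    show "(\<lambda>(k, L, R). glue L R) ` ?S = Av231 (Suc n)"
    proof (intro equalityI subsetI)
      fix p assume "p \<in> (\<lambda>(k, L, R). glue L R) ` ?S"
      then show "p \<in> Av231 (Suc n)" using glue_Av231[of _ _ _ "n - _"] by fastforce
    next
      fix p assume "p \<in> Av231 (Suc n)"
      then show "p \<in> (\<lambda>(k, L, R). glue L R) ` ?S" by (elim Av231_SucE) force
    qed
  qed
  then have "(\<Sum>p\<in>Av231 (Suc n). w p) = (\<Sum>(k, L, R)\<in>?S. w (glue L R))"
    by (subst sum.reindex_bij_betw[symmetric]) (auto simp: case_prod_unfold)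
  also have "\<dots> = (\<Sum>k\<le>n. \<Sum>L\<in>Av231 k. \<Sum>R\<in>Av231 (n - k). w (glue L R))"
    by (subst sum.Sigma[symmetric]) (auto simp: sum.cartesian_product Av231_def)
  finally show ?thesis .
qed

section \<open>Statistics on words\<close>

fun adjacent_count :: "('a \<Rightarrow> 'a \<Rightarrow> bool) \<Rightarrow> 'a list \<Rightarrow> nat" where
  "adjacent_count P (a # b # xs) = of_bool (P a b) + adjacent_count P (b # xs)"
| "adjacent_count P _ = 0"

fun vincular_count :: "('a \<Rightarrow> 'a \<Rightarrow> 'a \<Rightarrow> bool) \<Rightarrow> 'a list \<Rightarrow> nat" where
  "vincular_count P (a # b # xs) = length (filter (P a b) xs) + vincular_count P (b # xs)"
| "vincular_count P _ = 0"

abbreviation asc :: "'a::linorder list \<Rightarrow> nat" where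
  "asc \<equiv> adjacent_count (<)"

abbreviation occ_31_2 :: "'a::linorder list \<Rightarrow> nat" where
  "occ_31_2 \<equiv> vincular_count (\<lambda>a b c. b < c \<and> c < a)"

abbreviation occ_13_2 :: "'a::linorder list \<Rightarrow> nat" where
  "occ_13_2 \<equiv> vincular_count (\<lambda>a b c. a < c \<and> c < b)"

definition above_hd :: "'a::linorder list \<Rightarrow> nat" where
  "above_hd p = length (filter (\<lambda>x. hd p < x) p)"

definition below_hd :: "'a::linorder list \<Rightarrow> nat" where
  "below_hd p = length (filter (\<lambda>x. x < hd p) p)"

lemma card_adjacent_eq_adjacent_count:
  "card {i. Suc i < length p \<and> P (p ! i) (p ! Suc i)} = adjacent_count P p"
proof (induction P p rule: adjacent_count.induct)
  case (1 P a b xs)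
  let ?S = "{i. Suc i < length (b # xs) \<and> P ((b # xs) ! i) ((b # xs) ! Suc i)}"
  have "{i. Suc i < length (a # b # xs) \<and> P ((a # b # xs) ! i) ((a # b # xs) ! Suc i)}
      = (if P a b then {0} else {}) \<union> Suc ` ?S" (is "?T = _")
  proof (intro equalityI subsetI)
    fix i assume "i \<in> ?T"
    then show "i \<in> (if P a b then {0} else {}) \<union> Suc ` ?S" by (cases i) auto
  qed (auto split: if_splits)
  moreover have "finite ?S" by (rule finite_subset[of _ "{..<length (b # xs)}"]) auto
  ultimately show ?case using 1 by (simp add: card_Un_disjoint card_image card_insert_if)
qed auto

lemma card_vincular_eq_vincular_count:
  "card {(i, j). Suc i < j \<and> j < length p \<and> P (p ! i) (p ! Suc i) (p ! j)} = vincular_count P p"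
proof (induction P p rule: vincular_count.induct)
  case (1 P a b xs)
  let ?occ = "\<lambda>p. {(i, j). Suc i < j \<and> j < length p \<and> P (p ! i) (p ! Suc i) (p ! j)}"
  let ?S = "{j. j < length xs \<and> P a b (xs ! j)}"
  have split: "?occ (a # b # xs) = (\<lambda>j. (0, Suc (Suc j))) ` ?S \<union> map_prod Suc Suc ` ?occ (b # xs)"
  proof (intro equalityI subsetI)
    fix x assume "x \<in> ?occ (a # b # xs)"
    then obtain i j where x: "x = (i, j)" "Suc i < j" "j < length (a # b # xs)"
      "P ((a # b # xs) ! i) ((a # b # xs) ! Suc i) ((a # b # xs) ! j)" by blast
    show "x \<in> (\<lambda>j. (0, Suc (Suc j))) ` ?S \<union> map_prod Suc Suc ` ?occ (b # xs)"
    proof (cases i)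
      case 0
      then have "x = (0, Suc (Suc (j - 2)))" "j - 2 \<in> ?S" using x by (auto simp: numeral_2_eq_2)
      then show ?thesis by blast
    next
      case (Suc i')
      then obtain j' where "j = Suc j'" using x by (cases j) auto
      then have "x = map_prod Suc Suc (i', j')" "(i', j') \<in> ?occ (b # xs)" using x Suc by auto
      then show ?thesis by blast
    qed
  qed auto
  have "finite (?occ (b # xs))"
    by (rule finite_subset[of _ "{..<length (b # xs)} \<times> {..<length (b # xs)}"]) auto
  then have "card (?occ (a # b # xs)) = card ?S + card (?occ (b # xs))"
    unfolding split by (subst card_Un_disjoint) (auto simp: card_image inj_on_def)
  then show ?case using 1 by (simp add: length_filter_conv_card)
qed (auto simp: card_eq_0_iff)

lemma card_vincular_rev_eq_vincular_count:
  "card {(i, j). j < i \<and> Suc i < length p \<and> P (p ! i) (p ! Suc i) (p ! j)} =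
    vincular_count (\<lambda>a b c. P b a c) (rev p)"
proof -
  let ?f = "\<lambda>(i, j). (length p - Suc (Suc i), length p - Suc j)"
  have "bij_betw ?f {(i, j). j < i \<and> Suc i < length p \<and> P (p ! i) (p ! Suc i) (p ! j)}
    {(i, j). Suc i < j \<and> j < length (rev p) \<and> P (rev p ! Suc i) (rev p ! i) (rev p ! j)}"
    by (rule bij_betw_byWitness[of _ ?f]) (auto simp: rev_nth Suc_diff_Suc)
  then show ?thesis
    unfolding card_vincular_eq_vincular_count[symmetric] by (rule bij_betw_same_card)
qed

lemma des_eq_adjacent_count: "des p = adjacent_count (>) p"
  unfolding des_def by (rule card_adjacent_eq_adjacent_count)

lemma st31_2_eq_occ: "st31_2 p = occ_31_2 p"
  unfolding st31_2_def by (rule card_vincular_eq_vincular_count)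

lemma st13_2_eq_occ: "st13_2 p = occ_13_2 p"
  unfolding st13_2_def by (rule card_vincular_eq_vincular_count)

lemma st2_31_eq_occ_rev: "st2_31 p = occ_13_2 (rev p)"
  unfolding st2_31_def by (rule card_vincular_rev_eq_vincular_count)

lemma st2_13_eq_occ_rev: "st2_13 p = occ_31_2 (rev p)"
  unfolding st2_13_def by (rule card_vincular_rev_eq_vincular_count)

lemma adjacent_count_append:
  "adjacent_count P (xs @ y # ys) = adjacent_count P (xs @ [y]) + adjacent_count P (y # ys)"
  by (induction P xs rule: adjacent_count.induct) auto

lemma adjacent_count_snoc:
  "adjacent_count P (xs @ [y]) =
    adjacent_count P xs + (if xs = [] then 0 else of_bool (P (last xs) y))"
  by (induction P xs rule: adjacent_count.induct) auto

lemma adjacent_count_Cons: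
  "adjacent_count P (x # xs) = (if xs = [] then 0 else of_bool (P x (hd xs))) + adjacent_count P xs"
  by (cases xs) auto

lemma adjacent_count_rev: "adjacent_count P (rev p) = adjacent_count (\<lambda>a b. P b a) p"
  by (induction p) (auto simp: adjacent_count_snoc adjacent_count_Cons last_rev)

lemma adjacent_count_map: "adjacent_count P (map f p) = adjacent_count (\<lambda>a b. P (f a) (f b)) p"
  by (induction p rule: induct_list012) auto

lemma adjacent_count_cong:
  assumes "\<And>a b. a \<in> set p \<Longrightarrow> b \<in> set p \<Longrightarrow> P a b \<longleftrightarrow> P' a b"
  shows "adjacent_count P p = adjacent_count P' p"
  using assms by (induction P p rule: adjacent_count.induct) auto

lemma des_rev: "des (rev p) = asc p"
  by (simp add: des_eq_adjacent_count adjacent_count_rev)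

lemma asc_plus_des:
  assumes "distinct p"
  shows "asc p + des p = length p - 1"
  unfolding des_eq_adjacent_count using assms
  by (induction "(<) :: nat \<Rightarrow> nat \<Rightarrow> bool" p rule: adjacent_count.induct) auto

lemma vincular_count_map:
  "vincular_count P (map f p) = vincular_count (\<lambda>a b c. P (f a) (f b) (f c)) p"
  by (induction p rule: induct_list012) (auto simp: filter_map comp_def)

lemma vincular_count_cong:
  assumes "\<And>a b c. a \<in> set p \<Longrightarrow> b \<in> set p \<Longrightarrow> c \<in> set p \<Longrightarrow> P a b c \<longleftrightarrow> P' a b c"
  shows "vincular_count P p = vincular_count P' p"
  using assms
proof (induction P p rule: vincular_count.induct)
  case (1 P a b xs)
  then have "filter (P a b) xs = filter (P' a b) xs" by (intro filter_cong) auto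
  with 1 show ?case by simp
qed auto

lemma vincular_count_append:
  assumes "\<And>a b c. a \<in> set xs \<Longrightarrow> b \<in> set xs \<Longrightarrow> c \<in> set (y # ys) \<Longrightarrow> \<not> P a b c"
  shows "vincular_count P (xs @ y # ys) = vincular_count P xs +
    (if xs = [] then 0 else length (filter (P (last xs) y) ys)) + vincular_count P (y # ys)"
  using assms
proof (induction P xs rule: vincular_count.induct)
  case (1 P a b xs)
  then have "filter (P a b) (y # ys) = []" by (intro filter_False) auto
  then have "\<not> P a b y" "filter (P a b) ys = []" by (auto split: if_splits)
  with 1 show ?case by simp
qed auto

lemma occ_31_2_Cons_max:
  assumes "\<And>x. x \<in> set p \<Longrightarrow> x < m"
  shows "occ_31_2 (m # p) = occ_31_2 p + above_hd p"
proof (cases p)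
  case (Cons a xs)
  then have "filter (\<lambda>c. a < c \<and> c < m) xs = filter ((<) a) xs"
    using assms by (intro filter_cong) auto
  then show ?thesis using Cons by (simp add: above_hd_def)
qed (simp add: above_hd_def)

lemma occ_13_2_Cons_max:
  assumes "\<And>x. x \<in> set p \<Longrightarrow> x < m"
  shows "occ_13_2 (m # p) = occ_13_2 p"
proof (cases p)
  case (Cons a xs)
  then have "filter (\<lambda>c. m < c \<and> c < a) xs = []"
    using assms by (intro filter_False) force
  then show ?thesis using Cons by simp
qed simp

section \<open>Alternating words and coderangements\<close>

fun updown :: "bool \<Rightarrow> 'a::linorder list \<Rightarrow> bool" where
  "updown u (a # b # xs) \<longleftrightarrow> (if u then a < b else b < a) \<and> updown (\<not> u) (b # xs)"
| "updown u _ \<longleftrightarrow> True"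

lemma updown_iff_nth:
  "updown u p \<longleftrightarrow>
    (\<forall>i. Suc i < length p \<longrightarrow> (if even i = u then p ! i < p ! Suc i else p ! Suc i < p ! i))"
proof (induction u p rule: updown.induct)
  case (1 u a b xs)
  have all_nat_split: "(\<forall>i. Q i) \<longleftrightarrow> Q 0 \<and> (\<forall>i. Q (Suc i))" for Q
    by (metis not0_implies_Suc)
  from 1 show ?case by (subst all_nat_split) auto
qed auto

lemma alternating_iff_updown: "alternating p \<longleftrightarrow> updown True p"
  unfolding alternating_def updown_iff_nth by auto

lemma updown_append:
  "updown u (xs @ y # ys) \<longleftrightarrow> updown u (xs @ [y]) \<and> updown (even (length xs) = u) (y # ys)"
  by (induction u xs rule: updown.induct) auto

lemma updown_snoc_max:
  assumes "\<And>x. x \<in> set xs \<Longrightarrow> x < m"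
  shows "updown u (xs @ [m]) \<longleftrightarrow> updown u xs \<and> (xs = [] \<or> odd (length xs) = u)"
  using assms by (induction u xs rule: updown.induct) auto

lemma updown_Cons_max:
  assumes "\<And>x. x \<in> set xs \<Longrightarrow> x < m"
  shows "updown u (m # xs) \<longleftrightarrow> xs = [] \<or> \<not> u \<and> updown True xs"
  using assms[of "hd xs"] by (cases xs) auto

definition foremax_free :: "'a::linorder list \<Rightarrow> bool" where
  "foremax_free p \<longleftrightarrow>
    (\<forall>xs a ys. p = xs @ a # ys \<longrightarrow> (\<forall>x\<in>set xs. x < a) \<longrightarrow> ys \<noteq> [] \<and> hd ys < a)"

lemma coderangement_imp_foremax_free:
  assumes p: "p \<in> perms n" and coder: "coderangement p"
  shows "foremax_free p"
  unfolding foremax_free_def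
proof (intro allI impI)
  fix xs a ys assume split: "p = xs @ a # ys" and max: "\<forall>x\<in>set xs. x < a"
  have "p ! k \<le> a" if "k \<le> length xs" for k
    using that max by (auto simp: split nth_append less_imp_le)
  moreover have "ext p (length xs) = a" by (simp add: ext_def split)
  ultimately have "\<not> a < ext p (Suc (length xs))"
    using coder unfolding coderangement_def foremax_def
    by (auto simp: split dest!: spec[of _ "length xs"])
  moreover have "hd ys \<noteq> a" if "ys \<noteq> []"
    using that p by (cases ys) (auto simp: in_perms_iff split)
  moreover have "a < Suc (length p)"
    using perms_bounds[OF p, of a] length_perms[OF p] by (simp add: split)
  ultimately show "ys \<noteq> [] \<and> hd ys < a"
    by (cases ys) (auto simp: ext_def split nth_append)
qed

lemma foremax_free_imp_coderangement:
  assumes dist: "distinct p" and free: "foremax_free p"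
  shows "coderangement p"
  unfolding coderangement_def
proof (intro allI notI)
  fix i assume "foremax p i"
  then have i: "i < length p" "p ! i < ext p (Suc i)" and max: "\<forall>k\<le>i. p ! k \<le> p ! i"
    by (auto simp: foremax_def ext_def)
  have "x < p ! i" if "x \<in> set (take i p)" for x
  proof -
    from that obtain k where "k < i" "x = p ! k" using i(1) by (auto simp: in_set_conv_nth)
    moreover from this have "p ! k \<noteq> p ! i"
      using dist i(1) by (simp add: nth_eq_iff_index_eq)
    ultimately show ?thesis using max by (simp add: order.not_eq_order_implies_strict)
  qed
  moreover have "p = take i p @ p ! i # drop (Suc i) p" using i(1) by (rule id_take_nth_drop)
  ultimately have "drop (Suc i) p \<noteq> [] \<and> hd (drop (Suc i) p) < p ! i"
    using free unfolding foremax_free_def by blast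
  then show False using i by (auto simp: ext_def hd_drop_conv_nth)
qed

lemma coderangement_iff_foremax_free: "p \<in> perms n \<Longrightarrow> coderangement p \<longleftrightarrow> foremax_free p"
  using coderangement_imp_foremax_free foremax_free_imp_coderangement by (auto simp: in_perms_iff)

lemma foremax_free_split_max:
  assumes xs: "\<And>x. x \<in> set xs \<Longrightarrow> x < m" and ys: "\<And>y. y \<in> set ys \<Longrightarrow> y < m"
  shows "foremax_free (xs @ m # ys) \<longleftrightarrow> foremax_free xs \<and> ys \<noteq> []"
proof
  assume free: "foremax_free (xs @ m # ys)"
  have "vs \<noteq> [] \<and> hd vs < a" if "xs = us @ a # vs" "\<forall>x\<in>set us. x < a" for us a vs
  proof -
    have "hd (vs @ m # ys) < a"
      using free that unfolding foremax_free_def by (metis append.assoc append_Cons)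
    then show ?thesis using xs[of a] that(1) by (cases vs) auto
  qed
  then show "foremax_free xs \<and> ys \<noteq> []"
    using free xs unfolding foremax_free_def by blast
next
  assume free: "foremax_free xs \<and> ys \<noteq> []"
  show "foremax_free (xs @ m # ys)"
    unfolding foremax_free_def
  proof (intro allI impI)
    fix us a vs assume eq: "xs @ m # ys = us @ a # vs" and max: "\<forall>x\<in>set us. x < a"
    then consider ws where "xs = us @ a # ws" "vs = ws @ m # ys" | "a = m" "vs = ys"
      | "m \<in> set us" "a \<in> set ys"
      by (auto simp: append_eq_append_conv2 Cons_eq_append_conv append_eq_Cons_conv)
    then show "vs \<noteq> [] \<and> hd vs < a"
    proof cases
      case 1
      then show ?thesis
        using free max unfolding foremax_free_def by (metis append_is_Nil_conv hd_append2)
    next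
      case 2
      then show ?thesis using free ys[of "hd ys"] by simp
    next
      case 3
      then show ?thesis using max ys[of a] by auto
    qed
  qed
qed

lemma foremax_free_map_strict_mono:
  assumes "strict_mono f"
  shows "foremax_free (map f p) \<longleftrightarrow> foremax_free p"
  unfolding foremax_free_def
proof (intro iffI allI impI)
  fix xs a ys
  assume free: "\<forall>xs a ys. map f p = xs @ a # ys \<longrightarrow> (\<forall>x\<in>set xs. x < a) \<longrightarrow> ys \<noteq> [] \<and> hd ys < a"
    and p: "p = xs @ a # ys" and "\<forall>x\<in>set xs. x < a"
  then have "\<forall>x\<in>set (map f xs). x < f a" by (simp add: strict_mono_less[OF assms])
  moreover have "map f p = map f xs @ f a # map f ys" by (simp add: p)
  ultimately have "map f ys \<noteq> [] \<and> hd (map f ys) < f a" using free by blast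
  then show "ys \<noteq> [] \<and> hd ys < a"
    by (cases ys) (simp_all add: strict_mono_less[OF assms])
next
  fix us b vs
  assume free: "\<forall>xs a ys. p = xs @ a # ys \<longrightarrow> (\<forall>x\<in>set xs. x < a) \<longrightarrow> ys \<noteq> [] \<and> hd ys < a"
    and "map f p = us @ b # vs" and max: "\<forall>x\<in>set us. x < b"
  then obtain xs a ys where "p = xs @ a # ys" "us = map f xs" "b = f a" "vs = map f ys"
    by (auto simp: map_eq_append_conv map_eq_Cons_conv)
  then show "vs \<noteq> [] \<and> hd vs < b"
    using free[rule_format, of xs a ys] max by (simp add: strict_mono_less[OF assms] hd_map)
qed

section \<open>Words split at their maximum\<close>

locale max_split =
  fixes L R :: "'a::linorder list" and m :: 'a
  assumes left_less_max: "x \<in> set L \<Longrightarrow> x < m"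
    and right_less_max: "y \<in> set R \<Longrightarrow> y < m"
    and left_less_right: "x \<in> set L \<Longrightarrow> y \<in> set R \<Longrightarrow> x < y"
begin

lemma asc_split: "asc (L @ m # R) = asc L + of_bool (L \<noteq> []) + asc R"
proof -
  have "asc (L @ [m]) = asc L + of_bool (L \<noteq> [])"
    using left_less_max by (simp add: adjacent_count_snoc)
  moreover have "asc (m # R) = asc R"
    using right_less_max[of "hd R"] by (cases R) auto
  ultimately show ?thesis by (simp add: adjacent_count_append[of _ L m R])
qed

lemma occ_13_2_split:
  "occ_13_2 (L @ m # R) = occ_13_2 L + (if L = [] then 0 else length R) + occ_13_2 R"
proof -
  have "filter (\<lambda>c. last L < c \<and> c < m) R = R" if "L \<noteq> []"
    using that by (intro filter_True) (simp add: left_less_right right_less_max)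
  moreover have "occ_13_2 (L @ m # R) = occ_13_2 L +
      (if L = [] then 0 else length (filter (\<lambda>c. last L < c \<and> c < m) R)) + occ_13_2 (m # R)"
    by (rule vincular_count_append) (use left_less_max left_less_right in force)
  ultimately show ?thesis using right_less_max by (simp add: occ_13_2_Cons_max)
qed

lemma below_hd_split: "below_hd (L @ m # R) = (if L = [] then length R else below_hd L)"
proof (cases L)
  case Nil
  then show ?thesis using right_less_max by (simp add: below_hd_def)
next
  case (Cons a xs)
  then have "filter (\<lambda>x. x < a) (m # R) = []"
    using left_less_max left_less_right by (intro filter_False) force
  then show ?thesis using Cons by (simp add: below_hd_def split: if_splits)
qed

lemma occ_31_2_split: "occ_31_2 (L @ m # R) = occ_31_2 L + (occ_31_2 R + above_hd R)"
proof -
  have "filter (\<lambda>c. m < c \<and> c < last L) R = []"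
    using right_less_max by (intro filter_False) force
  moreover have "occ_31_2 (L @ m # R) = occ_31_2 L +
      (if L = [] then 0 else length (filter (\<lambda>c. m < c \<and> c < last L) R)) + occ_31_2 (m # R)"
    by (rule vincular_count_append) (use left_less_max left_less_right in force)
  ultimately show ?thesis using right_less_max by (simp add: occ_31_2_Cons_max)
qed

lemma above_hd_split:
  "above_hd (L @ m # R) = (if L = [] then 0 else above_hd L + Suc (length R))"
proof (cases L)
  case Nil
  then show ?thesis using right_less_max by (force simp: above_hd_def filter_empty_conv)
next
  case (Cons a xs)
  then have "filter (\<lambda>x. a < x) (m # R) = m # R"
    using left_less_max left_less_right by (intro filter_True) force
  then show ?thesis using Cons by (simp add: above_hd_def split: if_splits)
qed

lemma occ_31_2_rev_split:
  "occ_31_2 (rev (L @ m # R)) = occ_31_2 (rev R) + (occ_31_2 (rev L) + above_hd (rev L))"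
proof -
  have "filter (\<lambda>c. m < c \<and> c < last (rev R)) (rev L) = []"
    using left_less_max by (intro filter_False) force
  moreover have "occ_31_2 (rev R @ m # rev L) = occ_31_2 (rev R) +
      (if rev R = [] then 0 else length (filter (\<lambda>c. m < c \<and> c < last (rev R)) (rev L))) +
      occ_31_2 (m # rev L)"
    by (rule vincular_count_append) (use right_less_max left_less_right in force)
  ultimately show ?thesis using left_less_max occ_31_2_Cons_max[of "rev L" m] by simp
qed

lemma above_hd_rev_split:
  "above_hd (rev (L @ m # R)) = (if R = [] then 0 else Suc (above_hd (rev R)))"
proof (cases "rev R")
  case Nil
  then show ?thesis using left_less_max by (force simp: above_hd_def filter_empty_conv)
next
  case (Cons a xs)
  then have "a \<in> set R" by (metis list.set_intros(1) set_rev)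
  then have "filter (\<lambda>x. a < x) (rev L) = []" "a < m"
    using left_less_right right_less_max by (force intro!: filter_False)+
  moreover have "R \<noteq> []" using Cons by auto
  ultimately show ?thesis using Cons by (simp add: above_hd_def)
qed

lemma updown_split:
  "updown True (L @ m # R) \<longleftrightarrow>
    L = [] \<and> R = [] \<or> odd (length L) \<and> updown True L \<and> updown True R"
  unfolding updown_append[of _ L m R] using left_less_max right_less_max
  by (auto simp: updown_snoc_max updown_Cons_max)

lemma foremax_free_rev_split:
  "foremax_free (rev (L @ m # R)) \<longleftrightarrow> L \<noteq> [] \<and> foremax_free (rev R)"
  using foremax_free_split_max[of "rev R" m "rev L"] left_less_max right_less_max by auto

end

section \<open>Power series and q-dilations\<close>

definition dilate :: "'a::comm_ring_1 \<Rightarrow> 'a fps \<Rightarrow> 'a fps" where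
  "dilate q F = F oo (fps_const q * fps_X)"

lemma dilate_nth [simp]: "fps_nth (dilate q F) n = q ^ n * fps_nth F n"
  by (simp add: dilate_def)

lemma dilate_1_left [simp]: "dilate 1 F = F"
  by (simp add: fps_eq_iff)

lemma dilate_1 [simp]: "dilate q 1 = 1"
  by (simp add: dilate_def)

lemma dilate_const [simp]: "dilate q (fps_const c) = fps_const c"
  by (simp add: fps_eq_iff)

lemma dilate_X: "dilate q fps_X = fps_const q * fps_X"
  unfolding dilate_def by (rule fps_X_fps_compose_startby0) simp

lemma dilate_add: "dilate q (F + G) = dilate q F + dilate q G"
  by (simp add: dilate_def fps_compose_add_distrib)

lemma dilate_diff: "dilate q (F - G) = dilate q F - dilate q G"
  by (simp add: dilate_def fps_compose_sub_distrib)

lemma dilate_mult: "dilate q (F * G) = dilate q F * dilate q G"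
  for q :: "'a::idom"
  by (simp add: dilate_def fps_compose_mult_distrib)

lemma dilate_inverse: "fps_nth F 0 \<noteq> 0 \<Longrightarrow> dilate q (inverse F) = inverse (dilate q F)"
  for q :: "'a::field"
  by (simp add: dilate_def fps_inverse_compose)

lemmas dilate_simps = dilate_add dilate_diff dilate_mult dilate_X

lemma fps_mult_nth_cong:
  assumes "\<And>k. k \<le> n \<Longrightarrow> fps_nth F k = fps_nth F' k" "\<And>k. k \<le> n \<Longrightarrow> fps_nth G k = fps_nth G' k"
  shows "fps_nth (F * G) n = fps_nth (F' * G') n"
  using assms by (simp add: fps_mult_nth)

lemma q_quadratic_unique:
  fixes F G A a b c :: "'a::comm_ring_1 fps"
  assumes F: "F = A + fps_X * (a * F + b * dilate q F + c * (F * dilate q F))"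
    and G: "G = A + fps_X * (a * G + b * dilate q G + c * (G * dilate q G))"
  shows "F = G"
proof (rule fps_ext)
  fix n show "fps_nth F n = fps_nth G n"
  proof (induction n rule: less_induct)
    case (less n)
    show ?case
    proof (cases n)
      case 0
      then show ?thesis by (subst F, subst G) simp
    next
      case (Suc m)
      have "fps_nth F k = fps_nth G k" if "k \<le> m" for k using that Suc less by simp
      then have "fps_nth (a * F + b * dilate q F + c * (F * dilate q F)) m =
          fps_nth (a * G + b * dilate q G + c * (G * dilate q G)) m"
        unfolding fps_add_nth by (intro arg_cong2[of _ _ _ _ "(+)"] fps_mult_nth_cong) simp_all
      then show ?thesis by (subst F, subst G) (simp add: Suc)
    qed
  qed
qed

lemma q_square_unique:
  fixes F G A :: "'a::comm_ring_1 fps"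
  assumes "F = A + fps_const c * fps_X * (F * dilate q F)"
    and "G = A + fps_const c * fps_X * (G * dilate q G)"
  shows "F = G"
  by (rule q_quadratic_unique[of F A 0 0 q "fps_const c" G];
      rule trans[OF assms(1)] trans[OF assms(2)]; simp add: ac_simps)

section \<open>The S-fraction of the Carlitz--Riordan numbers\<close>

lemma sfrac_trunc_nth_0: "fps_nth (sfrac_trunc c k d) 0 = 1"
  by (cases d) simp_all

lemma sfrac_trunc_Suc_eq:
  "sfrac_trunc c k (Suc d) =
    1 + fps_const (c k) * fps_X * (sfrac_trunc c k (Suc d) * sfrac_trunc c (Suc k) d)"
proof -
  let ?B = "1 - fps_const (c k) * fps_X * sfrac_trunc c (Suc k) d"
  have "inverse ?B * ?B = 1" by (rule inverse_mult_eq_1) simp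
  then show ?thesis by (simp add: algebra_simps)
qed

lemma sfrac_trunc_nth_Suc:
  "fps_nth (sfrac_trunc c k (Suc d)) (Suc n) =
    c k * fps_nth (sfrac_trunc c k (Suc d) * sfrac_trunc c (Suc k) d) n"
  by (subst sfrac_trunc_Suc_eq) (simp only: fps_add_nth mult.assoc fps_mult_left_const_nth, simp)

lemma sfrac_trunc_stable:
  "n \<le> d \<Longrightarrow> n \<le> d' \<Longrightarrow> fps_nth (sfrac_trunc c k d) n = fps_nth (sfrac_trunc c k d') n"
proof (induction n arbitrary: k d d' rule: less_induct)
  case (less n)
  show ?case
  proof (cases n)
    case (Suc m)
    then obtain e e' where "d = Suc e" "d' = Suc e'" "m \<le> e" "m \<le> e'"
      using less.prems by (metis Suc_le_D Suc_le_mono)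
    then show ?thesis
      unfolding Suc by (simp only: sfrac_trunc_nth_Suc)
        (intro arg_cong2[of _ _ _ _ "(*)"] refl fps_mult_nth_cong less.IH; simp add: Suc)
  qed (simp add: sfrac_trunc_nth_0)
qed

lemma sfrac_nth: "n \<le> d \<Longrightarrow> fps_nth (sfrac c) n = fps_nth (sfrac_trunc c 1 d) n"
  unfolding sfrac_def fps_nth_Abs_fps by (intro sfrac_trunc_stable) simp_all

lemma sfrac_trunc_dilate:
  assumes "\<And>j. k \<le> j \<Longrightarrow> c (Suc j) = Q * c j"
  shows "sfrac_trunc c (Suc k) d = dilate Q (sfrac_trunc c k d)"
  using assms
proof (induction d arbitrary: k)
  case (Suc d)
  then have "sfrac_trunc c (Suc (Suc k)) d = dilate Q (sfrac_trunc c (Suc k) d)" by simp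
  then show ?case
    by (simp add: dilate_inverse dilate_simps Suc.prems ac_simps flip: fps_const_mult)
qed simp

lemma sfrac_geometric:
  assumes "\<And>j. 0 < j \<Longrightarrow> c (Suc j) = Q * c j"
  shows "sfrac c = 1 + fps_const (c 1) * fps_X * (sfrac c * dilate Q (sfrac c))"
proof (rule fps_ext)
  fix n show "fps_nth (sfrac c) n =
    fps_nth (1 + fps_const (c 1) * fps_X * (sfrac c * dilate Q (sfrac c))) n"
  proof (cases n)
    case 0
    then show ?thesis by (simp add: sfrac_def)
  next
    case (Suc m)
    let ?T = "sfrac_trunc c 1"
    have T_nth: "fps_nth (?T d) k = fps_nth (sfrac c) k" if "k \<le> d" for k d
      using that by (rule sfrac_nth[symmetric])
    have "fps_nth (sfrac c) n = fps_nth (?T (Suc n)) (Suc m)"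
      unfolding Suc by (rule sfrac_nth) simp
    also have "\<dots> = c 1 * fps_nth (?T (Suc n) * dilate Q (?T n)) m"
      unfolding sfrac_trunc_nth_Suc using assms by (subst sfrac_trunc_dilate[where Q = Q]) simp_all
    also have "fps_nth (?T (Suc n) * dilate Q (?T n)) m = fps_nth (sfrac c * dilate Q (sfrac c)) m"
      using Suc by (intro fps_mult_nth_cong)
        (simp_all add: T_nth del: sfrac_trunc.simps One_nat_def)
    finally show ?thesis by (simp add: Suc mult.assoc)
  qed
qed

lemma cat_weight_Suc:
  assumes "0 < j"
  shows "cat_weight Q (Q\<^sup>2) (Suc j) = Q * cat_weight Q (Q\<^sup>2) j"
proof (cases "odd j")
  case False
  then have "j div 2 = Suc (j div 2 - 1)" using assms by presburger
  then have "(Q\<^sup>2) ^ (j div 2) = Q\<^sup>2 * (Q\<^sup>2) ^ (j div 2 - 1)" by (metis power_Suc)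
  with False show ?thesis by (simp add: cat_weight_def power2_eq_square mult.assoc)
qed (auto simp: cat_weight_def elim: oddE)

definition carlitz_fps :: "'a::field \<Rightarrow> 'a fps" where
  "carlitz_fps Q = Abs_fps (\<lambda>n. Cq n Q)"

lemma carlitz_fps_eq: "carlitz_fps Q = 1 + fps_X * (carlitz_fps Q * dilate Q (carlitz_fps Q))"
proof -
  have "carlitz_fps Q = sfrac (cat_weight Q (Q\<^sup>2))"
    by (simp add: carlitz_fps_def fps_eq_iff Cq_def Ctq_def)
  moreover have "cat_weight Q (Q\<^sup>2) 1 = 1" by (simp add: cat_weight_def)
  ultimately show ?thesis using sfrac_geometric[of "cat_weight Q (Q\<^sup>2)" Q, OF cat_weight_Suc]
    by simp
qed

section \<open>Odd and even solutions\<close>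

lemma odd_solution_eq_carlitz_fps:
  fixes G :: "'a::field fps"
  assumes G: "G = fps_X + fps_const c * fps_X * (G * dilate q G)"
  shows "G = fps_X * (carlitz_fps (q\<^sup>2) oo (fps_const (c * q) * fps_X\<^sup>2))"
proof (rule q_square_unique[OF G])
  let ?u = "fps_const (c * q) * fps_X\<^sup>2" and ?C = "carlitz_fps (q\<^sup>2)"
  define F F' where "F = ?C oo ?u" and "F' = dilate (q\<^sup>2) ?C oo ?u"
  have u_nth_0: "fps_nth ?u 0 = 0" by simp
  have "dilate q F = ?C oo dilate q ?u"
    unfolding dilate_def F_def by (rule fps_compose_assoc[symmetric]) simp_all
  also have "dilate q ?u = fps_const (q\<^sup>2) * ?u"
    by (simp add: dilate_simps power2_eq_square ac_simps flip: fps_const_mult)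
  also have "\<dots> = (fps_const (q\<^sup>2) * fps_X) oo ?u"
    by (simp only: fps_compose_mult_distrib[OF u_nth_0] fps_const_compose
        fps_X_fps_compose_startby0[OF u_nth_0])
  also have "?C oo \<dots> = F'"
    unfolding dilate_def F'_def by (rule fps_compose_assoc) simp_all
  finally have dilate_F: "dilate q (fps_X * F) = fps_const q * fps_X * F'"
    by (simp add: dilate_simps)
  have "F = (1 + fps_X * (?C * dilate (q\<^sup>2) ?C)) oo ?u"
    unfolding F_def by (subst carlitz_fps_eq) (rule refl)
  also have "\<dots> = 1 + ?u * (F * F')"
    by (simp only: fps_compose_add_distrib fps_compose_mult_distrib[OF u_nth_0] fps_compose_1
        fps_X_fps_compose_startby0[OF u_nth_0] F_def F'_def)
  finally have "fps_X * F = fps_X * (1 + ?u * (F * F'))" by (rule arg_cong)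
  also have "\<dots> = fps_X + fps_const c * fps_X * (fps_X * F * (fps_const q * fps_X * F'))"
    unfolding fps_const_mult[symmetric] by (simp only: algebra_simps power2_eq_square mult_1_right)
  finally show "fps_X * (?C oo ?u) =
      fps_X + fps_const c * fps_X * (fps_X * (?C oo ?u) * dilate q (fps_X * (?C oo ?u)))"
    unfolding F_def[symmetric] dilate_F .
qed

lemma fps_compose_monomial_nth:
  "fps_nth (F oo (fps_const c * fps_X\<^sup>2)) n =
    (if even n then c ^ (n div 2) * fps_nth F (n div 2) else 0)"
  for c :: "'a::comm_ring_1"
proof -
  have "fps_nth ((fps_const c * fps_X\<^sup>2) ^ i) n = (if n = 2 * i then c ^ i else 0)" for i
    by (simp add: power_mult_distrib fps_const_power flip: power_mult)
  then have "fps_nth (F oo (fps_const c * fps_X\<^sup>2)) n =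
      (\<Sum>i\<in>{0..n}. if n = 2 * i then c ^ i * fps_nth F i else 0)"
    unfolding fps_compose_nth by (intro sum.cong) simp_all
  also have "\<dots> = (if even n then c ^ (n div 2) * fps_nth F (n div 2) else 0)"
    by (cases "even n") (auto elim!: evenE intro!: sum.neutral)
  finally show ?thesis .
qed

lemma odd_solution_nth:
  fixes G :: "'a::field fps"
  assumes "G = fps_X + fps_const c * fps_X * (G * dilate q G)"
  shows "fps_nth G n = (if odd n then (c * q) ^ (n div 2) * Cq (n div 2) (q\<^sup>2) else 0)"
  by (subst odd_solution_eq_carlitz_fps[OF assms])
    (cases n; simp add: fps_compose_monomial_nth carlitz_fps_def)

lemma even_solution_nth:
  fixes D E G A :: "'a::comm_ring_1 fps"
  assumes D: "D = 1 + fps_const y * fps_X * (G * dilate q D)"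
    and E: "E = 1 + fps_X * (A * dilate q E)"
    and G_nth: "\<And>n. fps_nth G n = y ^ (n div 2) * fps_nth A n"
    and A_odd: "\<And>n. even n \<Longrightarrow> fps_nth A n = 0"
    and E_even: "\<And>n. odd n \<Longrightarrow> fps_nth E n = 0"
  shows "fps_nth D n = y ^ (n div 2) * fps_nth E n"
proof (induction n rule: less_induct)
  case (less n)
  show ?case
  proof (cases n)
    case 0
    then show ?thesis by (subst D, subst E) simp
  next
    case (Suc m)
    have "y * (fps_nth G k * (q ^ (m - k) * fps_nth D (m - k))) =
        y ^ (n div 2) * (fps_nth A k * (q ^ (m - k) * fps_nth E (m - k)))" if "k \<le> m" for k
    proof (cases "odd k \<and> even (m - k)")
      case True
      then obtain i j where "k = 2 * i + 1" "m - k = 2 * j" by (elim conjE oddE evenE)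
      then have "n div 2 = Suc (k div 2 + (m - k) div 2)" using that Suc by simp
      then have "y ^ (n div 2) = y * (y ^ (k div 2) * y ^ ((m - k) div 2))"
        by (simp add: power_add)
      then show ?thesis using less[of "m - k"] Suc by (simp add: G_nth ac_simps)
    next
      case False
      then show ?thesis using less[of "m - k"] Suc A_odd[of k] E_even[of "m - k"]
        by (auto simp: G_nth)
    qed
    then have "y * fps_nth (G * dilate q D) m = y ^ (n div 2) * fps_nth (A * dilate q E) m"
      by (simp add: fps_mult_nth sum_distrib_left)
    then show ?thesis by (subst D, subst E) (simp add: Suc mult.assoc)
  qed
qed

section \<open>Statistics of glued permutations\<close>

lemma above_hd_map_strict_mono:
  assumes "strict_mono f"
  shows "above_hd (map f p) = above_hd p"
  using assms by (cases p) (simp_all add: above_hd_def filter_map comp_def strict_mono_less)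

lemma compl_stats:
  assumes p: "p \<in> perms n"
  shows "des (compl n p) = asc p"
    and "asc (compl n p) = des p"
    and "occ_31_2 (compl n p) = occ_13_2 p"
    and "occ_13_2 (compl n p) = occ_31_2 p"
    and "above_hd (compl n p) = below_hd p"
proof -
  have less: "Suc n - a < Suc n - b \<longleftrightarrow> b < a" if "a \<in> set p" "b \<in> set p" for a b
    using that perms_bounds[OF p] by (auto simp: diff_less_mono2 less_Suc_eq_le)
  show "des (compl n p) = asc p" "asc (compl n p) = des p"
    unfolding des_eq_adjacent_count compl_def adjacent_count_map
    by (intro adjacent_count_cong less; simp)+
  show "occ_31_2 (compl n p) = occ_13_2 p" "occ_13_2 (compl n p) = occ_31_2 p"
    unfolding compl_def vincular_count_map
    by (intro vincular_count_cong; auto simp: less)+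
  show "above_hd (compl n p) = below_hd p"
  proof (cases p)
    case (Cons a xs)
    then have "filter (\<lambda>x. Suc n - a < Suc n - x) p = filter (\<lambda>x. x < a) p"
      by (intro filter_cong refl less) simp_all
    then show ?thesis
      by (simp add: above_hd_def below_hd_def compl_def filter_map comp_def Cons)
  qed (simp add: above_hd_def below_hd_def compl_def)
qed

context
  fixes L R :: "nat list" and k l :: nat
  assumes L: "L \<in> perms k" and R: "R \<in> perms l"
begin

lemma glue_eq: "glue L R = L @ Suc (k + l) # map ((+) k) R"
  by (simp add: glue_def length_perms[OF L] length_perms[OF R])

lemma max_split_glue: "max_split L (map ((+) k) R) (Suc (k + l))"
  using perms_bounds[OF L] perms_bounds[OF R] by unfold_locales force+

lemma asc_glue: "asc (glue L R) = asc L + of_bool (L \<noteq> []) + asc R"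
  by (simp add: glue_eq max_split.asc_split[OF max_split_glue] adjacent_count_map)

lemma occ_13_2_glue:
  "occ_13_2 (glue L R) = occ_13_2 L + (if L = [] then 0 else length R) + occ_13_2 R"
  by (simp add: glue_eq max_split.occ_13_2_split[OF max_split_glue] vincular_count_map)

lemma below_hd_glue: "below_hd (glue L R) = (if L = [] then length R else below_hd L)"
  by (simp add: glue_eq max_split.below_hd_split[OF max_split_glue])

lemma occ_31_2_glue: "occ_31_2 (glue L R) = occ_31_2 L + (occ_31_2 R + above_hd R)"
  by (simp add: glue_eq max_split.occ_31_2_split[OF max_split_glue] vincular_count_map
      above_hd_map_strict_mono strict_mono_plus)

lemma above_hd_glue: "above_hd (glue L R) = (if L = [] then 0 else above_hd L + Suc (length R))"
  by (simp add: glue_eq max_split.above_hd_split[OF max_split_glue])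

lemma occ_31_2_rev_glue:
  "occ_31_2 (rev (glue L R)) = occ_31_2 (rev R) + (occ_31_2 (rev L) + above_hd (rev L))"
  unfolding glue_eq max_split.occ_31_2_rev_split[OF max_split_glue]
  by (simp add: rev_map vincular_count_map)

lemma above_hd_rev_glue:
  "above_hd (rev (glue L R)) = (if R = [] then 0 else Suc (above_hd (rev R)))"
  unfolding glue_eq max_split.above_hd_rev_split[OF max_split_glue]
  by (simp add: rev_map above_hd_map_strict_mono strict_mono_plus)

lemma alternating_glue:
  "alternating (glue L R) \<longleftrightarrow>
    L = [] \<and> R = [] \<or> odd (length L) \<and> alternating L \<and> alternating R"
proof -
  have "updown True (map ((+) k) R) \<longleftrightarrow> updown True R"
    unfolding updown_iff_nth by simp
  then show ?thesis
    unfolding alternating_iff_updown glue_eq max_split.updown_split[OF max_split_glue] by simp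
qed

lemma foremax_free_rev_glue: "foremax_free (rev (glue L R)) \<longleftrightarrow> L \<noteq> [] \<and> foremax_free (rev R)"
  unfolding glue_eq max_split.foremax_free_rev_split[OF max_split_glue]
  by (simp add: rev_map foremax_free_map_strict_mono strict_mono_plus)

end

section \<open>Generating functions of 231-avoiders\<close>

definition gf_231 :: "(nat list \<Rightarrow> 'a::comm_ring_1) \<Rightarrow> 'a fps" where
  "gf_231 w = Abs_fps (\<lambda>n. \<Sum>p\<in>Av231 n. w p)"

lemma gf_231_nth: "fps_nth (gf_231 w) n = (\<Sum>p\<in>Av231 n. w p)"
  by (simp add: gf_231_def)

lemma gf_231_nth_0 [simp]: "fps_nth (gf_231 w) 0 = w []"
  by (simp add: gf_231_nth Av231_0)

lemma Av231_length: "p \<in> Av231 n \<Longrightarrow> length p = n"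
  by (simp add: Av231_iff length_perms)

lemma Av231_imp_perms: "p \<in> Av231 n \<Longrightarrow> p \<in> perms n"
  by (simp add: Av231_iff)

lemma gf_231_zero: "gf_231 (\<lambda>p. 0) = 0"
  by (simp add: fps_eq_iff gf_231_nth)

lemma gf_231_cmult: "gf_231 (\<lambda>p. c * w p) = fps_const c * gf_231 w"
  by (simp add: fps_eq_iff gf_231_nth sum_distrib_left)

lemma gf_231_dilate: "gf_231 (\<lambda>p. q ^ length p * w p) = dilate q (gf_231 w)"
  by (simp add: fps_eq_iff gf_231_nth sum_distrib_left Av231_length)

lemma gf_231_Nil: "gf_231 (\<lambda>p. if p = [] then c else w p) = fps_const (c - w []) + gf_231 w"
proof (rule fps_ext)
  fix n show "fps_nth (gf_231 (\<lambda>p. if p = [] then c else w p)) n =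
    fps_nth (fps_const (c - w []) + gf_231 w) n"
  proof (cases "n = 0")
    case False
    then have "p \<noteq> []" if "p \<in> Av231 n" for p using Av231_length[OF that] by auto
    with False show ?thesis by (simp add: gf_231_nth cong: sum.cong)
  qed simp
qed

lemma gf_231_glue:
  assumes "\<And>k l L R. L \<in> perms k \<Longrightarrow> R \<in> perms l \<Longrightarrow>
    w (glue L R) = (if L = [] then v R else u L * v' R)"
  shows "gf_231 w = fps_const (w []) +
    fps_X * (gf_231 v + (gf_231 u - fps_const (u [])) * gf_231 v')"
proof (rule fps_ext)
  fix n show "fps_nth (gf_231 w) n = fps_nth (fps_const (w []) +
    fps_X * (gf_231 v + (gf_231 u - fps_const (u [])) * gf_231 v')) n"
  proof (cases n)
    case (Suc m)
    have "(\<Sum>L\<in>Av231 k. \<Sum>R\<in>Av231 (m - k). w (glue L R)) =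
        (if k = 0 then fps_nth (gf_231 v) m else 0) +
        fps_nth (gf_231 u - fps_const (u [])) k * fps_nth (gf_231 v') (m - k)" for k
    proof (cases "k = 0")
      case True
      have "w (glue [] R) = v R" if "R \<in> Av231 m" for R
        using assms[of "[]" 0 R m] that by (simp add: perms_0 Av231_iff)
      with True show ?thesis by (simp add: Av231_0 gf_231_nth)
    next
      case False
      then have "w (glue L R) = u L * v' R" if "L \<in> Av231 k" "R \<in> Av231 (m - k)" for L R
        using assms[of L k R "m - k"] that Av231_length[OF that(1)] by (auto simp: Av231_iff)
      with False show ?thesis by (simp add: gf_231_nth sum_product)
    qed
    then have "fps_nth (gf_231 w) n =
        fps_nth (gf_231 v + (gf_231 u - fps_const (u [])) * gf_231 v') m"
      unfolding Suc gf_231_nth[of w] sum_Av231_Suc fps_add_nth fps_mult_nth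
      by (simp add: sum.distrib atMost_atLeast0)
    then show ?thesis by (simp add: Suc)
  qed simp
qed

definition gf_13_2 :: "'a::field \<Rightarrow> 'a \<Rightarrow> 'a fps" where
  "gf_13_2 x q = gf_231 (\<lambda>p. x ^ asc p * q ^ occ_13_2 p)"

definition gf_13_2_below :: "'a::field \<Rightarrow> 'a \<Rightarrow> 'a fps" where
  "gf_13_2_below x q = gf_231 (\<lambda>p. x ^ asc p * q ^ (occ_13_2 p + below_hd p))"

definition gf_31_2 :: "'a::field \<Rightarrow> 'a \<Rightarrow> 'a fps" where
  "gf_31_2 x q = gf_231 (\<lambda>p. x ^ asc p * q ^ occ_31_2 p)"

definition gf_31_2_above :: "'a::field \<Rightarrow> 'a \<Rightarrow> 'a fps" where
  "gf_31_2_above x q = gf_231 (\<lambda>p. x ^ asc p * q ^ (occ_31_2 p + above_hd p))"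

definition gf_rev_31_2_above :: "'a::field \<Rightarrow> 'a \<Rightarrow> 'a fps" where
  "gf_rev_31_2_above x q = gf_231 (\<lambda>p. x ^ asc p * q ^ (occ_31_2 (rev p) + above_hd (rev p)))"

definition gf_foremax_free_13_2 :: "'a::field \<Rightarrow> 'a \<Rightarrow> 'a fps" where
  "gf_foremax_free_13_2 x q =
    gf_231 (\<lambda>p. of_bool (foremax_free (rev p)) * (x ^ asc p * q ^ occ_13_2 p))"

definition gf_foremax_free_rev_31_2 :: "'a::field \<Rightarrow> 'a \<Rightarrow> 'a fps" where
  "gf_foremax_free_rev_31_2 x q =
    gf_231 (\<lambda>p. of_bool (foremax_free (rev p)) * (x ^ asc p * q ^ occ_31_2 (rev p)))"

definition gf_odd_alternating_13_2 :: "'a::field \<Rightarrow> 'a fps" where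
  "gf_odd_alternating_13_2 q =
    gf_231 (\<lambda>p. of_bool (odd (length p) \<and> alternating p) * q ^ occ_13_2 p)"

definition gf_even_alternating_13_2 :: "'a::field \<Rightarrow> 'a fps" where
  "gf_even_alternating_13_2 q =
    gf_231 (\<lambda>p. of_bool (even (length p) \<and> alternating p) * q ^ occ_13_2 p)"

definition gf_odd_alternating_rev_31_2_above :: "'a::field \<Rightarrow> 'a fps" where
  "gf_odd_alternating_rev_31_2_above q = gf_231 (\<lambda>p. of_bool (odd (length p) \<and> alternating p) *
    q ^ (occ_31_2 (rev p) + above_hd (rev p)))"

definition gf_even_alternating_rev_31_2 :: "'a::field \<Rightarrow> 'a fps" where
  "gf_even_alternating_rev_31_2 q =
    gf_231 (\<lambda>p. of_bool (even (length p) \<and> alternating p) * q ^ occ_31_2 (rev p))"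

lemma alternating_Nil [simp]: "alternating []"
  by (simp add: alternating_def)

lemma foremax_free_Nil [simp]: "foremax_free []"
  by (simp add: foremax_free_def)

lemma hd_counts_Nil [simp]: "above_hd [] = 0" "below_hd [] = 0"
  by (simp_all add: above_hd_def below_hd_def)

lemma gf_13_2_eq:
  fixes x q :: "'a::field"
  defines "S \<equiv> gf_13_2 x q"
  shows "S = 1 + fps_X * (S + fps_const x * (S - 1) * dilate q S)"
proof -
  let ?w = "\<lambda>p::nat list. x ^ asc p * q ^ occ_13_2 p"
  have "?w (glue L R) = (if L = [] then ?w R else x * ?w L * (q ^ length R * ?w R))"
    if "L \<in> perms k" "R \<in> perms l" for L R k l
    unfolding asc_glue[OF that] occ_13_2_glue[OF that]
    by (simp add: power_add ac_simps)
  from gf_231_glue[of ?w ?w "\<lambda>L. x * ?w L" "\<lambda>R. q ^ length R * ?w R", OF this]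
  show ?thesis
    unfolding gf_231_dilate gf_231_cmult S_def gf_13_2_def by (simp add: algebra_simps)
qed

lemma gf_13_2_below_eq:
  fixes x q :: "'a::field"
  defines "S \<equiv> gf_13_2 x q" and "Z \<equiv> gf_13_2_below x q"
  shows "Z = 1 + fps_X * ((1 + fps_const x * (Z - 1)) * dilate q S)"
proof -
  let ?w = "\<lambda>p::nat list. x ^ asc p * q ^ (occ_13_2 p + below_hd p)"
    and ?v = "\<lambda>p::nat list. q ^ length p * (x ^ asc p * q ^ occ_13_2 p)"
  have "?w (glue L R) = (if L = [] then ?v R else x * ?w L * ?v R)"
    if "L \<in> perms k" "R \<in> perms l" for L R k l
    unfolding asc_glue[OF that] occ_13_2_glue[OF that] below_hd_glue[OF that]
    by (simp add: power_add ac_simps)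
  from gf_231_glue[of ?w ?v "\<lambda>L. x * ?w L" ?v, OF this]
  show ?thesis
    unfolding gf_231_dilate gf_231_cmult S_def Z_def gf_13_2_def gf_13_2_below_def
    by (simp add: algebra_simps)
qed

lemma gf_31_2_eq:
  fixes x q :: "'a::field"
  defines "T \<equiv> gf_31_2 x q" and "M \<equiv> gf_31_2_above x q"
  shows "T = 1 + fps_X * ((1 + fps_const x * (T - 1)) * M)"
proof -
  let ?w = "\<lambda>p::nat list. x ^ asc p * q ^ occ_31_2 p"
    and ?v = "\<lambda>p::nat list. x ^ asc p * q ^ (occ_31_2 p + above_hd p)"
  have "?w (glue L R) = (if L = [] then ?v R else x * ?w L * ?v R)"
    if "L \<in> perms k" "R \<in> perms l" for L R k l
    unfolding asc_glue[OF that] occ_31_2_glue[OF that]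
    by (simp add: power_add ac_simps)
  from gf_231_glue[of ?w ?v "\<lambda>L. x * ?w L" ?v, OF this]
  show ?thesis
    unfolding gf_231_cmult T_def M_def gf_31_2_def gf_31_2_above_def by (simp add: algebra_simps)
qed

lemma gf_31_2_above_eq:
  fixes x q :: "'a::field"
  defines "M \<equiv> gf_31_2_above x q"
  shows "M = 1 + fps_X * (M + fps_const (x * q) * (M - 1) * dilate q M)"
proof -
  let ?w = "\<lambda>p::nat list. x ^ asc p * q ^ (occ_31_2 p + above_hd p)"
  have "?w (glue L R) = (if L = [] then ?w R else x * q * ?w L * (q ^ length R * ?w R))"
    if "L \<in> perms k" "R \<in> perms l" for L R k l
    unfolding asc_glue[OF that] occ_31_2_glue[OF that] above_hd_glue[OF that]
    by (simp add: power_add ac_simps)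
  from gf_231_glue[of ?w ?w "\<lambda>L. x * q * ?w L" "\<lambda>R. q ^ length R * ?w R", OF this]
  show ?thesis
    unfolding gf_231_dilate gf_231_cmult M_def gf_31_2_above_def by (simp add: algebra_simps)
qed

lemma gf_rev_31_2_above_eq:
  fixes x q :: "'a::field"
  defines "M \<equiv> gf_rev_31_2_above x q"
  shows "M = 1 + fps_X * ((1 + fps_const x * (M - 1)) * (1 + fps_const q * (M - 1)))"
proof -
  let ?w = "\<lambda>p::nat list. x ^ asc p * q ^ (occ_31_2 (rev p) + above_hd (rev p))"
  let ?v = "\<lambda>p::nat list. if p = [] then 1 else q * ?w p"
  have "?w (glue L R) = (if L = [] then ?v R else x * ?w L * ?v R)"
    if "L \<in> perms k" "R \<in> perms l" for L R k l
    unfolding asc_glue[OF that] occ_31_2_rev_glue[OF that] above_hd_rev_glue[OF that]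
    by (simp add: power_add ac_simps)
  from gf_231_glue[of ?w ?v "\<lambda>L. x * ?w L" ?v, OF this]
  show ?thesis
    unfolding gf_231_Nil gf_231_cmult M_def gf_rev_31_2_above_def
    by (simp add: algebra_simps fps_const_sub[symmetric] del: fps_const_sub)
qed

lemma gf_foremax_free_13_2_eq:
  fixes x q :: "'a::field"
  defines "D \<equiv> gf_foremax_free_13_2 x q" and "S \<equiv> gf_13_2 x q"
  shows "D = 1 + fps_const x * fps_X * ((S - 1) * dilate q D)"
proof -
  let ?u = "\<lambda>p::nat list. x ^ asc p * q ^ occ_13_2 p"
  let ?w = "\<lambda>p::nat list. of_bool (foremax_free (rev p)) * ?u p"
  have "?w (glue L R) = (if L = [] then 0 else x * ?u L * (q ^ length R * ?w R))"
    if "L \<in> perms k" "R \<in> perms l" for L R k l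
    unfolding asc_glue[OF that] occ_13_2_glue[OF that] foremax_free_rev_glue[OF that]
    by (simp add: power_add ac_simps)
  from gf_231_glue[of ?w "\<lambda>R. 0" "\<lambda>L. x * ?u L" "\<lambda>R. q ^ length R * ?w R", OF this]
  show ?thesis
    unfolding gf_231_dilate gf_231_cmult gf_231_zero D_def S_def gf_13_2_def
      gf_foremax_free_13_2_def
    by (simp add: algebra_simps)
qed

lemma gf_foremax_free_rev_31_2_eq:
  fixes x q :: "'a::field"
  defines "D \<equiv> gf_foremax_free_rev_31_2 x q" and "M \<equiv> gf_rev_31_2_above x q"
  shows "D = 1 + fps_const x * fps_X * ((M - 1) * D)"
proof -
  let ?u = "\<lambda>p::nat list. x ^ asc p * q ^ (occ_31_2 (rev p) + above_hd (rev p))"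
  let ?w = "\<lambda>p::nat list. of_bool (foremax_free (rev p)) * (x ^ asc p * q ^ occ_31_2 (rev p))"
  have "?w (glue L R) = (if L = [] then 0 else x * ?u L * ?w R)"
    if "L \<in> perms k" "R \<in> perms l" for L R k l
    unfolding asc_glue[OF that] occ_31_2_rev_glue[OF that] foremax_free_rev_glue[OF that]
    by (simp add: power_add ac_simps)
  from gf_231_glue[of ?w "\<lambda>R. 0" "\<lambda>L. x * ?u L" ?w, OF this]
  show ?thesis
    unfolding gf_231_cmult gf_231_zero D_def M_def gf_rev_31_2_above_def
      gf_foremax_free_rev_31_2_def
    by (simp add: algebra_simps)
qed

lemma gf_odd_alternating_13_2_eq:
  fixes q :: "'a::field"
  defines "A \<equiv> gf_odd_alternating_13_2 q"
  shows "A = fps_X + fps_X * (A * dilate q A)"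
proof -
  let ?w = "\<lambda>p::nat list. of_bool (odd (length p) \<and> alternating p) * q ^ occ_13_2 p"
  have "?w (glue L R) =
      (if L = [] then (if R = [] then 1 else 0) else ?w L * (q ^ length R * ?w R))"
    if "L \<in> perms k" "R \<in> perms l" for L R k l
    unfolding length_glue alternating_glue[OF that] occ_13_2_glue[OF that]
    by (auto simp: power_add)
  from gf_231_glue[of ?w "\<lambda>R. if R = [] then 1 else 0" ?w "\<lambda>R. q ^ length R * ?w R", OF this]
  show ?thesis
    unfolding gf_231_dilate gf_231_Nil gf_231_zero A_def gf_odd_alternating_13_2_def
    by (simp add: algebra_simps)
qed

lemma gf_even_alternating_13_2_eq:
  fixes q :: "'a::field"
  defines "E \<equiv> gf_even_alternating_13_2 q" and "A \<equiv> gf_odd_alternating_13_2 q"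
  shows "E = 1 + fps_X * (A * dilate q E)"
proof -
  let ?u = "\<lambda>p::nat list. of_bool (odd (length p) \<and> alternating p) * q ^ occ_13_2 p"
  let ?w = "\<lambda>p::nat list. of_bool (even (length p) \<and> alternating p) * q ^ occ_13_2 p"
  have "?w (glue L R) = (if L = [] then 0 else ?u L * (q ^ length R * ?w R))"
    if "L \<in> perms k" "R \<in> perms l" for L R k l
    unfolding length_glue alternating_glue[OF that] occ_13_2_glue[OF that]
    by (auto simp: power_add)
  from gf_231_glue[of ?w "\<lambda>R. 0" ?u "\<lambda>R. q ^ length R * ?w R", OF this]
  show ?thesis
    unfolding gf_231_dilate gf_231_zero A_def E_def gf_odd_alternating_13_2_def
      gf_even_alternating_13_2_def
    by (simp add: algebra_simps)
qed

lemma gf_odd_alternating_rev_31_2_above_eq: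
  fixes q :: "'a::field"
  defines "A \<equiv> gf_odd_alternating_rev_31_2_above q"
  shows "A = fps_X + fps_const q * fps_X * (A * A)"
proof -
  let ?w = "\<lambda>p::nat list. of_bool (odd (length p) \<and> alternating p) *
    q ^ (occ_31_2 (rev p) + above_hd (rev p))"
  have "?w (glue L R) = (if L = [] then (if R = [] then 1 else 0) else ?w L * (q * ?w R))"
    if "L \<in> perms k" "R \<in> perms l" for L R k l
    unfolding length_glue alternating_glue[OF that] occ_31_2_rev_glue[OF that]
      above_hd_rev_glue[OF that]
    by (auto simp: power_add)
  from gf_231_glue[of ?w "\<lambda>R. if R = [] then 1 else 0" ?w "\<lambda>R. q * ?w R", OF this]
  show ?thesis
    unfolding gf_231_cmult gf_231_Nil gf_231_zero A_def gf_odd_alternating_rev_31_2_above_def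
    by (simp add: algebra_simps)
qed

lemma gf_even_alternating_rev_31_2_eq:
  fixes q :: "'a::field"
  defines "E \<equiv> gf_even_alternating_rev_31_2 q" and "A \<equiv> gf_odd_alternating_rev_31_2_above q"
  shows "E = 1 + fps_X * (A * E)"
proof -
  let ?u = "\<lambda>p::nat list. of_bool (odd (length p) \<and> alternating p) *
    q ^ (occ_31_2 (rev p) + above_hd (rev p))"
  let ?w = "\<lambda>p::nat list. of_bool (even (length p) \<and> alternating p) * q ^ occ_31_2 (rev p)"
  have "?w (glue L R) = (if L = [] then 0 else ?u L * ?w R)"
    if "L \<in> perms k" "R \<in> perms l" for L R k l
    unfolding length_glue alternating_glue[OF that] occ_31_2_rev_glue[OF that]
    by (auto simp: power_add)
  from gf_231_glue[of ?w "\<lambda>R. 0" ?u ?w, OF this]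
  show ?thesis
    unfolding gf_231_zero A_def E_def gf_odd_alternating_rev_31_2_above_def
      gf_even_alternating_rev_31_2_def
    by (simp add: algebra_simps)
qed

section \<open>Evaluation at \<open>-1\<close> and \<open>-q\<close>\<close>

lemma gf_31_2_above_eq_gf_13_2: "gf_31_2_above x q = gf_13_2 (x * q) q"
proof (rule q_quadratic_unique)
  show "gf_31_2_above x q = 1 + fps_X * (1 * gf_31_2_above x q +
      - fps_const (x * q) * dilate q (gf_31_2_above x q) +
      fps_const (x * q) * (gf_31_2_above x q * dilate q (gf_31_2_above x q)))"
    by (rule trans[OF gf_31_2_above_eq]) (simp add: algebra_simps flip: fps_const_neg)
  show "gf_13_2 (x * q) q = 1 + fps_X * (1 * gf_13_2 (x * q) q +
      - fps_const (x * q) * dilate q (gf_13_2 (x * q) q) +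
      fps_const (x * q) * (gf_13_2 (x * q) q * dilate q (gf_13_2 (x * q) q)))"
    by (rule trans[OF gf_13_2_eq]) (simp add: algebra_simps flip: fps_const_neg)
qed

lemma gf_13_2_minus_one_eq:
  fixes q :: "'a::field"
  defines "G \<equiv> gf_13_2 (- 1) q - 1"
  shows "G = fps_X + fps_const (- 1) * fps_X * (G * dilate q G)"
proof -
  have "1 + G = gf_13_2 (- 1) q" by (simp add: G_def)
  also have "\<dots> = 1 + fps_X * (1 - G * dilate q G)"
    by (rule trans[OF gf_13_2_eq]) (simp add: G_def dilate_simps algebra_simps flip: fps_const_neg)
  finally show ?thesis by (simp add: algebra_simps flip: fps_const_neg)
qed

lemma gf_31_2_minus_one_reciprocal:
  fixes q :: "'a::field"
  shows "(1 - (gf_31_2 (- 1) q - 1)) * (1 + fps_X * gf_13_2 (- q) q) = 1"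
proof -
  define G where "G = gf_31_2 (- 1) q - 1"
  have "1 + G = gf_31_2 (- 1) q" by (simp add: G_def)
  also have "\<dots> = 1 + fps_X * ((1 - G) * gf_13_2 (- q) q)"
    by (rule trans[OF gf_31_2_eq])
      (simp add: G_def gf_31_2_above_eq_gf_13_2 flip: fps_const_neg)
  finally have "(1 - G) * (1 + fps_X * gf_13_2 (- q) q) = 1" by (simp add: algebra_simps)
  then show ?thesis by (simp only: G_def)
qed

lemma dilate_gf_31_2_minus_one_reciprocal:
  fixes q :: "'a::field"
  shows "(1 - dilate q (gf_31_2 (- 1) q - 1)) *
    (1 + fps_const q * fps_X * dilate q (gf_13_2 (- q) q)) = 1"
proof -
  define G where "G = gf_31_2 (- 1) q - 1"
  have "dilate q ((1 - G) * (1 + fps_X * gf_13_2 (- q) q)) = 1"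
    unfolding G_def gf_31_2_minus_one_reciprocal by simp
  then show ?thesis unfolding G_def[symmetric] by (simp add: dilate_simps mult.assoc)
qed

lemma gf_31_2_minus_one_eq:
  fixes q :: "'a::field"
  defines "G \<equiv> gf_31_2 (- 1) q - 1" and "H \<equiv> gf_13_2 (- q) q"
  shows "G = fps_X + fps_const (- 1) * fps_X * (G * dilate q G)"
proof -
  define W where "W = 1 + fps_const q * fps_X * dilate q H"
  have reciprocal: "(1 - G) * (1 + fps_X * H) = 1"
    unfolding G_def H_def by (rule gf_31_2_minus_one_reciprocal)
  have reciprocal_W: "(1 - dilate q G) * W = 1"
    unfolding G_def H_def W_def by (rule dilate_gf_31_2_minus_one_reciprocal)
  have "H = 1 + fps_X * (H + fps_const (- q) * (H - 1) * dilate q H)"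
    unfolding H_def by (rule gf_13_2_eq)
  then have "H * (W - fps_X) = W" by (simp add: W_def algebra_simps flip: fps_const_neg)
  then have "(1 - dilate q G) * (H * (W - fps_X)) = 1" using reciprocal_W by simp
  moreover have "(1 - dilate q G) * (H * (W - fps_X)) =
      H * ((1 - dilate q G) * W - fps_X * (1 - dilate q G))"
    by (simp add: algebra_simps)
  ultimately have inverse_H: "H * (1 - fps_X * (1 - dilate q G)) = 1" unfolding reciprocal_W by simp
  have "G = fps_X * (1 - G) * H" using reciprocal by (simp add: algebra_simps)
  then have "G * (1 - fps_X * (1 - dilate q G)) =
      fps_X * (1 - G) * (H * (1 - fps_X * (1 - dilate q G)))"
    by (metis mult.assoc)
  then have "G * (1 - fps_X * (1 - dilate q G)) = fps_X * (1 - G)" unfolding inverse_H by simp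
  then show ?thesis by (simp add: algebra_simps flip: fps_const_neg)
qed

lemma gf_13_2_below_minus_q:
  fixes q :: "'a::field"
  defines "G \<equiv> gf_31_2 (- 1) q - 1" and "Z \<equiv> gf_13_2_below (- q) q - 1"
  shows "fps_const q * Z = dilate q G"
proof -
  let ?W = "1 + fps_const q * fps_X * dilate q (gf_13_2 (- q) q)"
  have reciprocal: "(1 - dilate q G) * ?W = 1"
    unfolding G_def by (rule dilate_gf_31_2_minus_one_reciprocal)
  define U where "U = 1 - fps_const q * Z"
  have "1 + Z = gf_13_2_below (- q) q" by (simp add: Z_def)
  also have "\<dots> = 1 + fps_X * (U * dilate q (gf_13_2 (- q) q))"
    by (rule trans[OF gf_13_2_below_eq]) (simp add: U_def Z_def flip: fps_const_neg)
  finally have Z_eq: "fps_X * (U * dilate q (gf_13_2 (- q) q)) = Z" by simp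
  have "U * ?W = U + fps_const q * (fps_X * (U * dilate q (gf_13_2 (- q) q)))"
    by (simp add: algebra_simps)
  also have "\<dots> = 1" unfolding Z_eq by (simp add: U_def)
  finally have "U * ?W = 1" .
  moreover have "U * ((1 - dilate q G) * ?W) = (1 - dilate q G) * (U * ?W)"
    by (rule mult.left_commute)
  ultimately have "U = 1 - dilate q G" unfolding reciprocal by simp
  then show ?thesis by (simp add: U_def)
qed

lemma gf_rev_31_2_above_minus_q_eq:
  fixes q :: "'a::field"
  defines "G \<equiv> gf_rev_31_2_above (- q) q - 1"
  shows "G = fps_X + fps_const (- (q\<^sup>2)) * fps_X * (G * dilate 1 G)"
proof -
  have "1 + G = gf_rev_31_2_above (- q) q" by (simp add: G_def)
  also have "\<dots> = 1 + fps_X * ((1 - fps_const q * G) * (1 + fps_const q * G))"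
    by (rule trans[OF gf_rev_31_2_above_eq]) (simp add: G_def flip: fps_const_neg)
  finally show ?thesis
    by (simp add: algebra_simps power2_eq_square flip: fps_const_neg fps_const_mult)
qed

definition signed_carlitz :: "nat \<Rightarrow> 'a::field \<Rightarrow> 'a" where
  "signed_carlitz n q = eps_odd n ((- q) ^ ((n - 1) div 2) * Cq ((n - 1) div 2) (q\<^sup>2))"

lemma minus_one_odd_solution_nth:
  fixes F :: "'a::field fps"
  assumes "F - 1 = fps_X + fps_const (- 1) * fps_X * ((F - 1) * dilate q (F - 1))"
  shows "fps_nth (F - 1) n = signed_carlitz n q"
proof -
  have "odd n \<Longrightarrow> (n - 1) div 2 = n div 2" by (auto elim: oddE)
  then show ?thesis
    unfolding odd_solution_nth[OF assms] by (simp add: signed_carlitz_def eps_odd_def)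
qed

lemma gf_13_2_minus_one_nth: "0 < n \<Longrightarrow> fps_nth (gf_13_2 (- 1) q) n = signed_carlitz n q"
  using minus_one_odd_solution_nth[OF gf_13_2_minus_one_eq, of q n] by simp

lemma gf_31_2_minus_one_nth: "0 < n \<Longrightarrow> fps_nth (gf_31_2 (- 1) q) n = signed_carlitz n q"
  using minus_one_odd_solution_nth[OF gf_31_2_minus_one_eq, of q n] by simp

lemma gf_even_alternating_nth_odd:
  assumes "odd n"
  shows "fps_nth (gf_even_alternating_13_2 q) n = 0"
    and "fps_nth (gf_even_alternating_rev_31_2 q) n = 0"
  using assms
  by (simp_all add: gf_even_alternating_13_2_def gf_even_alternating_rev_31_2_def gf_231_nth
      Av231_length cong: sum.cong)

lemma gf_foremax_free_13_2_minus_one_nth: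
  "fps_nth (gf_foremax_free_13_2 (- 1) q) n =
    (- 1) ^ (n div 2) * fps_nth (gf_even_alternating_13_2 q) n"
proof (rule even_solution_nth[OF gf_foremax_free_13_2_eq gf_even_alternating_13_2_eq])
  have "gf_odd_alternating_13_2 q = fps_X + fps_const 1 * fps_X *
      (gf_odd_alternating_13_2 q * dilate q (gf_odd_alternating_13_2 q))"
    by (rule trans[OF gf_odd_alternating_13_2_eq]) (simp add: mult.assoc)
  note A_nth = odd_solution_nth[OF this]
  show "fps_nth (gf_odd_alternating_13_2 q) n = 0" if "even n" for n
    using that by (simp add: A_nth)
  show "fps_nth (gf_13_2 (- 1) q - 1) n = (- 1) ^ (n div 2) * fps_nth (gf_odd_alternating_13_2 q) n"
    for n
    unfolding A_nth odd_solution_nth[OF gf_13_2_minus_one_eq] by (simp add: power_minus[of q])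
qed (rule gf_even_alternating_nth_odd)

lemma gf_foremax_free_rev_31_2_minus_q_nth:
  "fps_nth (gf_foremax_free_rev_31_2 (- q) q) n =
    (- q) ^ (n div 2) * fps_nth (gf_even_alternating_rev_31_2 q) n"
proof (rule even_solution_nth[where q = 1])
  let ?A = "gf_odd_alternating_rev_31_2_above q"
  have "?A = fps_X + fps_const q * fps_X * (?A * dilate 1 ?A)"
    using gf_odd_alternating_rev_31_2_above_eq[of q] by simp
  note A_nth = odd_solution_nth[OF this]
  show "fps_nth ?A n = 0" if "even n" for n
    using that by (simp add: A_nth)
  show "fps_nth (gf_rev_31_2_above (- q) q - 1) n = (- q) ^ (n div 2) * fps_nth ?A n" for n
    unfolding A_nth odd_solution_nth[OF gf_rev_31_2_above_minus_q_eq]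
    by (simp add: power2_eq_square flip: power_mult_distrib)
  show "gf_foremax_free_rev_31_2 (- q) q = 1 + fps_const (- q) * fps_X *
      ((gf_rev_31_2_above (- q) q - 1) * dilate 1 (gf_foremax_free_rev_31_2 (- q) q))"
    using gf_foremax_free_rev_31_2_eq[of "- q" q] by simp
  show "gf_even_alternating_rev_31_2 q =
      1 + fps_X * (?A * dilate 1 (gf_even_alternating_rev_31_2 q))"
    using gf_even_alternating_rev_31_2_eq[of q] by simp
qed (rule gf_even_alternating_nth_odd)

lemma sum_alt_avoiders_231:
  "(\<Sum>p\<in>alt_avoiders n [2, 3, 1]. w p) = (\<Sum>p\<in>Av231 n. of_bool (alternating p) * w p)"
  for w :: "nat list \<Rightarrow> 'a::field"
  unfolding alt_avoiders_def Av231_def sum.inter_filter[OF finite_avoiders] by (intro sum.cong) auto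

lemma Chat_eq_gf: "Chat m q = fps_nth (gf_even_alternating_13_2 q) (2 * m)"
  unfolding Chat_def sum_alt_avoiders_231 st13_2_eq_occ gf_even_alternating_13_2_def gf_231_nth
  by (simp add: Av231_length cong: sum.cong)

lemma Cbar_eq_gf: "Cbar m q = fps_nth (gf_even_alternating_rev_31_2 q) (2 * m)"
  unfolding Cbar_def sum_alt_avoiders_231 st2_13_eq_occ_rev gf_even_alternating_rev_31_2_def
    gf_231_nth
  by (simp add: Av231_length cong: sum.cong)

section \<open>Avoiders of 132, 213 and 312\<close>

lemma sum_avoiders_132: "(\<Sum>p\<in>avoiders n [1, 3, 2]. w p) = (\<Sum>p\<in>Av231 n. w (rev p))"
  using sum_avoiders_rev[of w n "[2, 3, 1]"] by (simp add: Av231_def)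

lemma sum_avoiders_213: "(\<Sum>p\<in>avoiders n [2, 1, 3]. w p) = (\<Sum>p\<in>Av231 n. w (compl n p))"
proof -
  have "[2, 3, 1] \<in> perms 3" by (auto simp: in_perms_iff)
  moreover have "compl 3 [2, 3, 1] = [2, 1, 3]" by (simp add: compl_def)
  ultimately show ?thesis unfolding Av231_def by (metis sum_avoiders_compl)
qed

lemma sum_avoiders_312: "(\<Sum>p\<in>avoiders n [3, 1, 2]. w p) = (\<Sum>p\<in>Av231 n. w (rev (compl n p)))"
  using sum_avoiders_rev[of w n "[2, 1, 3]"] by (simp add: sum_avoiders_213 del: One_nat_def)

lemma sum_coder_avoiders_132:
  "(\<Sum>p\<in>coder_avoiders n [1, 3, 2]. w p) = (\<Sum>p\<in>Av231 n. of_bool (foremax_free (rev p)) * w (rev p))"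
  for w :: "nat list \<Rightarrow> 'a::field"
  unfolding coder_avoiders_def sum.inter_filter[OF finite_avoiders] sum_avoiders_132
  by (intro sum.cong) (auto simp: coderangement_iff_foremax_free[of _ n] Av231_iff)

lemma contains_213_Cons_max:
  assumes "\<And>x. x \<in> set p \<Longrightarrow> x < m"
  shows "contains (m # p) [2, 1, 3] \<longleftrightarrow> contains p [2, 1, 3]"
proof
  assume "contains (m # p) [2, 1, 3]"
  then obtain a b c where sub: "subseq [a, b, c] (m # p)"
    and iso: "order_isomorphic [a, b, c] [2, 1, 3 :: nat]"
    unfolding contains_triple_iff by blast
  have "a \<noteq> m"
  proof
    assume "a = m"
    then have "c \<in> set p" using sub subseq_imp_subset[of "[b, c]" p] by simp
    then show False using assms[of c] iso \<open>a = m\<close> by (simp add: order_isomorphic_triple_iff)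
  qed
  then show "contains p [2, 1, 3]"
    using sub iso unfolding contains_triple_iff by (auto split: if_splits)
next
  assume "contains p [2, 1, 3]"
  then show "contains (m # p) [2, 1, 3]" unfolding contains_iff_subseq by blast
qed

lemma coder_avoiders_213_hd:
  assumes p: "p \<in> coder_avoiders (Suc m) [2, 1, 3]"
  obtains q where "p = Suc m # q" "q \<noteq> []"
proof -
  have perm: "p \<in> perms (Suc m)" and avoid: "\<not> contains p [2, 1, 3]" and free: "foremax_free p"
    using p coderangement_iff_foremax_free by (auto simp: coder_avoiders_def avoiders_def)
  obtain a xs where "p = a # xs" using length_perms[OF perm] by (cases p) auto
  then have "xs \<noteq> [] \<and> hd xs < a"
    using free unfolding foremax_free_def by (metis append_Nil empty_iff empty_set)
  then obtain b ys where p_eq: "p = a # b # ys" and "b < a"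
    using \<open>p = a # xs\<close> by (cases xs) auto
  have "a = Suc m"
  proof (rule ccontr)
    assume "a \<noteq> Suc m"
    then have "a < Suc m" using perms_bounds[OF perm, of a] by (simp add: p_eq)
    moreover have "Suc m \<in> set p" using perm by (simp add: in_perms_iff)
    ultimately have "subseq [a, b, Suc m] p"
      using \<open>b < a\<close> by (auto simp: p_eq subseq_singleton_left)
    moreover have "order_isomorphic [a, b, Suc m] [2, 1, 3 :: nat]"
      using \<open>b < a\<close> \<open>a < Suc m\<close> by (simp add: order_isomorphic_triple_iff)
    ultimately show False using avoid unfolding contains_iff_subseq by blast
  qed
  then show ?thesis using p_eq by (intro that[of "b # ys"]) simp_all
qed

lemma Cons_max_perms_iff: "Suc m # p \<in> perms (Suc m) \<longleftrightarrow> p \<in> perms m"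
  using insert_ident[of "Suc m" "set p" "{1..m}"]
  by (auto simp: in_perms_iff atLeastAtMostSuc_conv)

lemma coder_avoiders_213_Suc:
  "coder_avoiders (Suc m) [2, 1, 3] = (if m = 0 then {} else (#) (Suc m) ` avoiders m [2, 1, 3])"
proof -
  have "Suc m # p \<in> coder_avoiders (Suc m) [2, 1, 3] \<longleftrightarrow> p \<in> avoiders m [2, 1, 3] \<and> p \<noteq> []" for p
  proof (cases "p \<in> perms m")
    case True
    then have less: "x < Suc m" if "x \<in> set p" for x
      using that perms_bounds by (simp add: less_Suc_eq_le)
    have "coderangement (Suc m # p) \<longleftrightarrow> p \<noteq> []"
      using True less foremax_free_split_max[of "[]" "Suc m" p]
      by (simp add: coderangement_iff_foremax_free[of _ "Suc m"] Cons_max_perms_iff)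
    with True less show ?thesis
      by (auto simp: coder_avoiders_def avoiders_def Cons_max_perms_iff contains_213_Cons_max
          simp del: One_nat_def)
  qed (simp add: coder_avoiders_def avoiders_def Cons_max_perms_iff)
  moreover have "p \<noteq> [] \<longleftrightarrow> m \<noteq> 0" if "p \<in> avoiders m [2, 1, 3]" for p
    using length_perms[OF avoiders_imp_perms[OF that]] by auto
  ultimately have mem: "Suc m # p \<in> coder_avoiders (Suc m) [2, 1, 3] \<longleftrightarrow>
      p \<in> avoiders m [2, 1, 3] \<and> m \<noteq> 0" for p
    by blast
  show ?thesis
  proof (intro equalityI subsetI)
    fix p assume p: "p \<in> coder_avoiders (Suc m) [2, 1, 3]"
    then obtain q where "p = Suc m # q" by (rule coder_avoiders_213_hd)
    with p show "p \<in> (if m = 0 then {} else (#) (Suc m) ` avoiders m [2, 1, 3])"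
      using mem by simp
  next
    fix p assume "p \<in> (if m = 0 then {} else (#) (Suc m) ` avoiders m [2, 1, 3])"
    then show "p \<in> coder_avoiders (Suc m) [2, 1, 3]"
      using mem by (auto split: if_splits)
  qed
qed

lemma sum_coder_avoiders_213_Suc:
  assumes "0 < m"
  shows "(\<Sum>p\<in>coder_avoiders (Suc m) [2, 1, 3]. w p) = (\<Sum>p\<in>Av231 m. w (Suc m # compl m p))"
  unfolding coder_avoiders_213_Suc using assms
  by (simp add: sum.reindex sum_avoiders_213 del: One_nat_def)

lemma Cons_max_compl_stats:
  assumes p: "p \<in> perms m" and "0 < m"
  shows "des (Suc m # compl m p) = Suc (asc p)"
    and "occ_31_2 (Suc m # compl m p) = occ_13_2 p + below_hd p"
    and "occ_13_2 (Suc m # compl m p) = occ_31_2 p"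
proof -
  have less: "x < Suc m" if "x \<in> set (compl m p)" for x
    using perms_bounds[OF compl_perms[OF p] that] by simp
  moreover have "compl m p \<noteq> []" using length_perms[OF p] \<open>0 < m\<close> by (auto simp: compl_def)
  ultimately have "des (Suc m # compl m p) = Suc (des (compl m p))"
    by (simp add: des_eq_adjacent_count adjacent_count_Cons)
  with less show "des (Suc m # compl m p) = Suc (asc p)"
    and "occ_31_2 (Suc m # compl m p) = occ_13_2 p + below_hd p"
    and "occ_13_2 (Suc m # compl m p) = occ_31_2 p"
    by (simp_all add: compl_stats[OF p] occ_31_2_Cons_max occ_13_2_Cons_max)
qed

section \<open>The signed sums\<close>

lemma minus_one_power_des:
  assumes "p \<in> Av231 n"
  shows "(- 1 :: 'a::ring_1) ^ des p = (- 1) ^ (n - 1) * (- 1) ^ asc p"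
proof -
  have "n - 1 = asc p + des p"
    using assms asc_plus_des[of p] length_perms[of p n] by (simp add: Av231_iff in_perms_iff)
  then show ?thesis by (simp add: power_add minus_one_power_iff)
qed

lemma minus_one_power_signed_carlitz: "(- 1) ^ (n - 1) * signed_carlitz n q = signed_carlitz n q"
  by (auto simp: signed_carlitz_def eps_odd_def)

lemma signed_sums_231:
  assumes "0 < n"
  shows "(\<Sum>p\<in>Av231 n. (- 1) ^ asc p * q ^ occ_13_2 p) = signed_carlitz n q"
    and "(\<Sum>p\<in>Av231 n. (- 1) ^ asc p * q ^ occ_31_2 p) = signed_carlitz n q"
    and "(\<Sum>p\<in>Av231 n. (- 1) ^ des p * q ^ occ_13_2 p) = signed_carlitz n q"
    and "(\<Sum>p\<in>Av231 n. (- 1) ^ des p * q ^ occ_31_2 p) = signed_carlitz n q"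
proof -
  show asc: "(\<Sum>p\<in>Av231 n. (- 1) ^ asc p * q ^ occ_13_2 p) = signed_carlitz n q"
    "(\<Sum>p\<in>Av231 n. (- 1) ^ asc p * q ^ occ_31_2 p) = signed_carlitz n q"
    using gf_13_2_minus_one_nth[OF assms, of q] gf_31_2_minus_one_nth[OF assms, of q]
    by (simp_all add: gf_13_2_def gf_31_2_def gf_231_nth)
  have "(\<Sum>p\<in>Av231 n. (- 1) ^ des p * w p) = (- 1) ^ (n - 1) * (\<Sum>p\<in>Av231 n. (- 1) ^ asc p * w p)"
    for w :: "nat list \<Rightarrow> 'a"
    by (simp add: sum_distrib_left minus_one_power_des mult.assoc cong: sum.cong)
  then show "(\<Sum>p\<in>Av231 n. (- 1) ^ des p * q ^ occ_13_2 p) = signed_carlitz n q"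
    "(\<Sum>p\<in>Av231 n. (- 1) ^ des p * q ^ occ_31_2 p) = signed_carlitz n q"
    by (simp_all only: asc minus_one_power_signed_carlitz)
qed

lemma signed_sums_132:
  assumes "0 < n"
  shows "(\<Sum>p\<in>avoiders n [1, 3, 2]. (- 1) ^ des p * q ^ st2_31 p) = signed_carlitz n q"
    and "(\<Sum>p\<in>avoiders n [1, 3, 2]. (- 1) ^ des p * q ^ st2_13 p) = signed_carlitz n q"
  unfolding sum_avoiders_132 des_rev st2_31_eq_occ_rev st2_13_eq_occ_rev rev_rev_ident
  by (rule signed_sums_231[OF assms])+

lemma signed_sums_213:
  assumes "0 < n"
  shows "(\<Sum>p\<in>avoiders n [2, 1, 3]. (- 1) ^ des p * q ^ st31_2 p) = signed_carlitz n q"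
    and "(\<Sum>p\<in>avoiders n [2, 1, 3]. (- 1) ^ des p * q ^ st13_2 p) = signed_carlitz n q"
  unfolding sum_avoiders_213 st31_2_eq_occ st13_2_eq_occ
  using signed_sums_231[OF assms, of q]
  by (simp_all add: compl_stats[OF Av231_imp_perms] cong: sum.cong)

lemma signed_sums_312:
  assumes "0 < n"
  shows "(\<Sum>p\<in>avoiders n [3, 1, 2]. (- 1) ^ des p * q ^ st2_31 p) = signed_carlitz n q"
    and "(\<Sum>p\<in>avoiders n [3, 1, 2]. (- 1) ^ des p * q ^ st2_13 p) = signed_carlitz n q"
  unfolding sum_avoiders_312 des_rev st2_31_eq_occ_rev st2_13_eq_occ_rev rev_rev_ident
  using signed_sums_231[OF assms, of q]
  by (simp_all add: compl_stats[OF Av231_imp_perms] cong: sum.cong)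

lemma signed_sum_coder_avoiders_132_st2_31:
  "(\<Sum>p\<in>coder_avoiders n [1, 3, 2]. (- 1) ^ des p * q ^ st2_31 p) =
    eps_even n ((- 1) ^ (n div 2) * Chat (n div 2) q)"
proof -
  have "(\<Sum>p\<in>coder_avoiders n [1, 3, 2]. (- 1) ^ des p * q ^ st2_31 p) =
      fps_nth (gf_foremax_free_13_2 (- 1) q) n"
    unfolding sum_coder_avoiders_132 des_rev st2_31_eq_occ_rev rev_rev_ident
    by (simp add: gf_foremax_free_13_2_def gf_231_nth)
  then show ?thesis
    by (simp add: gf_foremax_free_13_2_minus_one_nth eps_even_def Chat_eq_gf
        gf_even_alternating_nth_odd)
qed

lemma signed_sum_coder_avoiders_132_st31_2:
  "(\<Sum>p\<in>coder_avoiders n [1, 3, 2]. (- q) ^ des p * q ^ st31_2 p) =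
    eps_even n ((- q) ^ (n div 2) * Cbar (n div 2) q)"
proof -
  have "(\<Sum>p\<in>coder_avoiders n [1, 3, 2]. (- q) ^ des p * q ^ st31_2 p) =
      fps_nth (gf_foremax_free_rev_31_2 (- q) q) n"
    unfolding sum_coder_avoiders_132 des_rev st31_2_eq_occ
    by (simp add: gf_foremax_free_rev_31_2_def gf_231_nth)
  then show ?thesis
    by (simp add: gf_foremax_free_rev_31_2_minus_q_nth eps_even_def Cbar_eq_gf
        gf_even_alternating_nth_odd)
qed

lemma signed_sum_coder_avoiders_213_st13_2:
  assumes "0 < n"
  shows "(\<Sum>p\<in>coder_avoiders n [2, 1, 3]. (- 1) ^ des p * q ^ st13_2 p) =
    eps_even n ((- 1) ^ (n div 2) * q ^ ((n - 2) div 2) * Cq ((n - 2) div 2) (q\<^sup>2))"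
proof (cases "n = 1")
  case True
  then show ?thesis using coder_avoiders_213_Suc[of 0] by (simp add: eps_even_def)
next
  case False
  with assms obtain m where n: "n = Suc m" "0 < m" by (cases n) auto
  have "(\<Sum>p\<in>coder_avoiders n [2, 1, 3]. (- 1) ^ des p * q ^ st13_2 p) =
      (\<Sum>p\<in>Av231 m. - ((- 1) ^ asc p * q ^ occ_31_2 p))"
    unfolding n(1) sum_coder_avoiders_213_Suc[OF n(2)] st13_2_eq_occ
    using n(2) by (intro sum.cong refl) (simp add: Av231_iff Cons_max_compl_stats)
  also have "\<dots> = - signed_carlitz m q"
    using signed_sums_231(2)[OF n(2), of q] by (simp add: sum_negf)
  also have "\<dots> = eps_even n ((- 1) ^ (n div 2) * q ^ ((n - 2) div 2) * Cq ((n - 2) div 2) (q\<^sup>2))"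
    by (auto simp: signed_carlitz_def eps_odd_def eps_even_def n power_minus[of q] elim!: oddE)
  finally show ?thesis .
qed

lemma signed_sum_coder_avoiders_213_st31_2:
  assumes "0 < n"
  shows "(\<Sum>p\<in>coder_avoiders n [2, 1, 3]. (- q) ^ des p * q ^ st31_2 p) =
    eps_even n ((- 1) ^ (n div 2) * q ^ ((3 * n - 4) div 2) * Cq ((n - 2) div 2) (q\<^sup>2))"
proof (cases "n = 1")
  case True
  then show ?thesis using coder_avoiders_213_Suc[of 0] by (simp add: eps_even_def)
next
  case False
  with assms obtain m where n: "n = Suc m" "0 < m" by (cases n) auto
  have "(\<Sum>p\<in>coder_avoiders n [2, 1, 3]. (- q) ^ des p * q ^ st31_2 p) =
      (\<Sum>p\<in>Av231 m. - q * ((- q) ^ asc p * q ^ (occ_13_2 p + below_hd p)))"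
    unfolding n(1) sum_coder_avoiders_213_Suc[OF n(2)] st31_2_eq_occ
    using n(2) by (intro sum.cong refl) (simp add: Av231_iff Cons_max_compl_stats)
  also have "\<dots> = - fps_nth (fps_const q * (gf_13_2_below (- q) q - 1)) m"
    using n(2) by (simp add: gf_13_2_below_def gf_231_nth sum_distrib_left sum_negf)
  also have "\<dots> = - (q ^ m * signed_carlitz m q)"
    unfolding gf_13_2_below_minus_q using gf_31_2_minus_one_nth[OF n(2), of q] n(2) by simp
  also have "\<dots> =
      eps_even n ((- 1) ^ (n div 2) * q ^ ((3 * n - 4) div 2) * Cq ((n - 2) div 2) (q\<^sup>2))"
  proof (cases "odd m")
    case True
    then obtain j where m: "m = 2 * j + 1" by (elim oddE)
    have "(3 * n - 4) div 2 = m + j" "n div 2 = Suc j" "(n - 2) div 2 = j" "(m - 1) div 2 = j"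
      unfolding n(1) m by simp_all
    with True show ?thesis
      by (simp add: signed_carlitz_def eps_odd_def eps_even_def n(1) power_add power_minus[of q])
  next
    case False
    then show ?thesis by (simp add: signed_carlitz_def eps_odd_def eps_even_def n(1))
  qed
  finally show ?thesis .
qed

theorem theorem5p6:
  fixes n :: nat and q :: "'a::field"
  assumes "n \<ge> 1"
  shows
   "(\<Sum>p\<in>avoiders n [1,3,2]. (-1) ^ des p * q ^ st2_31 p) =
      eps_odd n ((-q) ^ ((n - 1) div 2) * Cq ((n - 1) div 2) (q^2)) \<and>
    (\<Sum>p\<in>avoiders n [1,3,2]. (-1) ^ des p * q ^ st2_13 p) =
      eps_odd n ((-q) ^ ((n - 1) div 2) * Cq ((n - 1) div 2) (q^2)) \<and>
    (\<Sum>p\<in>avoiders n [2,1,3]. (-1) ^ des p * q ^ st31_2 p) =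
      eps_odd n ((-q) ^ ((n - 1) div 2) * Cq ((n - 1) div 2) (q^2)) \<and>
    (\<Sum>p\<in>avoiders n [2,1,3]. (-1) ^ des p * q ^ st13_2 p) =
      eps_odd n ((-q) ^ ((n - 1) div 2) * Cq ((n - 1) div 2) (q^2)) \<and>
    (\<Sum>p\<in>avoiders n [3,1,2]. (-1) ^ des p * q ^ st2_31 p) =
      eps_odd n ((-q) ^ ((n - 1) div 2) * Cq ((n - 1) div 2) (q^2)) \<and>
    (\<Sum>p\<in>avoiders n [3,1,2]. (-1) ^ des p * q ^ st2_13 p) =
      eps_odd n ((-q) ^ ((n - 1) div 2) * Cq ((n - 1) div 2) (q^2)) \<and>
    (\<Sum>p\<in>coder_avoiders n [1,3,2]. (-1) ^ des p * q ^ st2_31 p) =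
      eps_even n ((-1) ^ (n div 2) * Chat (n div 2) q) \<and>
    (\<Sum>p\<in>coder_avoiders n [1,3,2]. (-q) ^ des p * q ^ st31_2 p) =
      eps_even n ((-q) ^ (n div 2) * Cbar (n div 2) q) \<and>
    (\<Sum>p\<in>coder_avoiders n [2,1,3]. (-1) ^ des p * q ^ st13_2 p) =
      eps_even n ((-1) ^ (n div 2) * q ^ ((n - 2) div 2) * Cq ((n - 2) div 2) (q^2)) \<and>
    (\<Sum>p\<in>coder_avoiders n [2,1,3]. (-q) ^ des p * q ^ st31_2 p) =
      eps_even n ((-1) ^ (n div 2) * q ^ ((3 * n - 4) div 2) * Cq ((n - 2) div 2) (q^2))"
proof -
  have n: "0 < n" using assms by simp
  note sums = signed_sums_132[OF n] signed_sums_213[OF n] signed_sums_312[OF n]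
  show ?thesis
    by (intro conjI sums[unfolded signed_carlitz_def] signed_sum_coder_avoiders_132_st2_31
        signed_sum_coder_avoiders_132_st31_2 signed_sum_coder_avoiders_213_st13_2[OF n]
        signed_sum_coder_avoiders_213_st31_2[OF n])
qed

end
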